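(* Over $\mathbf{ECST}$, the following two principles are equivalent: $\mathrm{NID}_{1}$: for each set $S$ and each set $R$ of elementary rules on $S$, the class of $R$-closed subsets of $S$ is set-generated; $\mathrm{NID}_{\mathrm{bi}}$: for each set $S$ and each set $R$ of rules on $S$, the class of $R$-biclosed subsets of $S$ is set-generated.
   Context: Base theory. $\mathbf{ECST}$ (elementary constructive set theory) is the theory in intuitionistic first-order logic with equality and $\in$ whose axioms are Extensionality, Pairing, Union, Restricted Separation (separation for formulas all of whose quantifiers are bounded), Replacement (for arbitrary formulas, with $\exists!$ in the hypothesis), and Strong Infinity (existence of the least set $\omega$ containing $\emptyset$ and closed under $x\mapsto x\cup\{x\}$). There is no power set axiom; $\mathrm{Pow}(S)$ denotes the class of subsets of $S$. Rules. A rule on a set $S$ is a pair $(a,b)$ of subsets of $S$; it is elementary if $a$ is a singleton. Write $b\between\alpha$ to mean that $b\cap\alpha$ is inhabited. A subset $\alpha\subseteq S$ is closed under $(a,b)$ if $a\subseteq\alpha$ implies $b\between\alpha$; it is biclosed under $(a,b)$ if $a\between\alpha\iff b\between\alpha$. For a set $R$ of rules, $\alpha$ is $R$-closed (resp. $R$-biclosed) if it is closed (resp. biclosed) under every rule in $R$. Set-generation. A subclass $\mathcal{C}$ of $\mathrm{Pow}(S)$ is set-generated if there is a set $G\subseteq\mathcal{C}$ such that $\forall\alpha\in\mathcal{C}\,\forall x\in\alpha\,\exists\beta\in G\,(x\in\beta\subseteq\alpha)$. *)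

theory Defs
  imports Main
begin

section \<open>Intuitionistic first-order logic with equality and membership\<close>

text \<open>
  Variables are de Bruijn indices. The language has no function symbols, so every term is a
  variable and substitution is renaming of variables.
\<close>

datatype fm =
    Mem nat nat  (infix "\<^bold>\<in>" 55)
  | Eq nat nat   (infix "\<^bold>=" 55)
  | Bot          ("\<^bold>\<bottom>")
  | And fm fm    (infixr "\<^bold>\<and>" 45)
  | Or fm fm     (infixr "\<^bold>\<or>" 40)
  | Imp fm fm    (infixr "\<^bold>\<longrightarrow>" 35)
  | Forall fm    ("\<^bold>\<forall> _" [50] 50)
  | Exists fm    ("\<^bold>\<exists> _" [50] 50)

definition Neg :: "fm \<Rightarrow> fm"  ("\<^bold>\<not> _" [50] 50)
  where "\<^bold>\<not> \<phi> = (\<phi> \<^bold>\<longrightarrow> \<^bold>\<bottom>)"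

definition Iff :: "fm \<Rightarrow> fm \<Rightarrow> fm"  (infix "\<^bold>\<longleftrightarrow>" 30)
  where "(\<phi> \<^bold>\<longleftrightarrow> \<psi>) = ((\<phi> \<^bold>\<longrightarrow> \<psi>) \<^bold>\<and> (\<psi> \<^bold>\<longrightarrow> \<phi>))"

text \<open>
  In the bounded quantifiers the bound \<open>a\<close> is an index of the surrounding context, whereas
  index 0 of the body is the quantified variable.
\<close>

definition BAll :: "nat \<Rightarrow> fm \<Rightarrow> fm"  ("\<^bold>\<forall>[_] _" [0, 50] 50)
  where "(\<^bold>\<forall>[a] \<phi>) = (\<^bold>\<forall> (0 \<^bold>\<in> Suc a \<^bold>\<longrightarrow> \<phi>))"

definition BEx :: "nat \<Rightarrow> fm \<Rightarrow> fm"  ("\<^bold>\<exists>[_] _" [0, 50] 50)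
  where "(\<^bold>\<exists>[a] \<phi>) = (\<^bold>\<exists> (0 \<^bold>\<in> Suc a \<^bold>\<and> \<phi>))"

definition lift :: "(nat \<Rightarrow> nat) \<Rightarrow> nat \<Rightarrow> nat"
  where "lift f n = (case n of 0 \<Rightarrow> 0 | Suc m \<Rightarrow> Suc (f m))"

primrec ren :: "(nat \<Rightarrow> nat) \<Rightarrow> fm \<Rightarrow> fm" where
  "ren f (x \<^bold>\<in> y) = (f x \<^bold>\<in> f y)"
| "ren f (x \<^bold>= y) = (f x \<^bold>= f y)"
| "ren f \<^bold>\<bottom> = \<^bold>\<bottom>"
| "ren f (\<phi> \<^bold>\<and> \<psi>) = (ren f \<phi> \<^bold>\<and> ren f \<psi>)"
| "ren f (\<phi> \<^bold>\<or> \<psi>) = (ren f \<phi> \<^bold>\<or> ren f \<psi>)"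
| "ren f (\<phi> \<^bold>\<longrightarrow> \<psi>) = (ren f \<phi> \<^bold>\<longrightarrow> ren f \<psi>)"
| "ren f (\<^bold>\<forall> \<phi>) = (\<^bold>\<forall> (ren (lift f) \<phi>))"
| "ren f (\<^bold>\<exists> \<phi>) = (\<^bold>\<exists> (ren (lift f) \<phi>))"

text \<open>Instantiation of variable 0, which is removed from the context.\<close>

definition inst :: "nat \<Rightarrow> fm \<Rightarrow> fm"
  where "inst t \<phi> = ren (\<lambda>n. case n of 0 \<Rightarrow> t | Suc m \<Rightarrow> m) \<phi>"

inductive derives :: "fm set \<Rightarrow> fm \<Rightarrow> bool"  (infix "\<turnstile>" 25) where
  hyp: "\<phi> \<in> \<Gamma> \<Longrightarrow> \<Gamma> \<turnstile> \<phi>"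
| botE: "\<Gamma> \<turnstile> \<^bold>\<bottom> \<Longrightarrow> \<Gamma> \<turnstile> \<phi>"
| andI: "\<Gamma> \<turnstile> \<phi> \<Longrightarrow> \<Gamma> \<turnstile> \<psi> \<Longrightarrow> \<Gamma> \<turnstile> \<phi> \<^bold>\<and> \<psi>"
| andE1: "\<Gamma> \<turnstile> \<phi> \<^bold>\<and> \<psi> \<Longrightarrow> \<Gamma> \<turnstile> \<phi>"
| andE2: "\<Gamma> \<turnstile> \<phi> \<^bold>\<and> \<psi> \<Longrightarrow> \<Gamma> \<turnstile> \<psi>"
| orI1: "\<Gamma> \<turnstile> \<phi> \<Longrightarrow> \<Gamma> \<turnstile> \<phi> \<^bold>\<or> \<psi>"
| orI2: "\<Gamma> \<turnstile> \<psi> \<Longrightarrow> \<Gamma> \<turnstile> \<phi> \<^bold>\<or> \<psi>"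
| orE: "\<Gamma> \<turnstile> \<phi> \<^bold>\<or> \<psi> \<Longrightarrow> insert \<phi> \<Gamma> \<turnstile> \<chi> \<Longrightarrow> insert \<psi> \<Gamma> \<turnstile> \<chi> \<Longrightarrow> \<Gamma> \<turnstile> \<chi>"
| impI: "insert \<phi> \<Gamma> \<turnstile> \<psi> \<Longrightarrow> \<Gamma> \<turnstile> \<phi> \<^bold>\<longrightarrow> \<psi>"
| impE: "\<Gamma> \<turnstile> \<phi> \<^bold>\<longrightarrow> \<psi> \<Longrightarrow> \<Gamma> \<turnstile> \<phi> \<Longrightarrow> \<Gamma> \<turnstile> \<psi>"
| allI: "ren Suc ` \<Gamma> \<turnstile> \<phi> \<Longrightarrow> \<Gamma> \<turnstile> \<^bold>\<forall> \<phi>"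
| allE: "\<Gamma> \<turnstile> \<^bold>\<forall> \<phi> \<Longrightarrow> \<Gamma> \<turnstile> inst t \<phi>"
| exI: "\<Gamma> \<turnstile> inst t \<phi> \<Longrightarrow> \<Gamma> \<turnstile> \<^bold>\<exists> \<phi>"
| exE: "\<Gamma> \<turnstile> \<^bold>\<exists> \<phi> \<Longrightarrow> insert \<phi> (ren Suc ` \<Gamma>) \<turnstile> ren Suc \<psi> \<Longrightarrow> \<Gamma> \<turnstile> \<psi>"
| eq_refl: "\<Gamma> \<turnstile> t \<^bold>= t"
| eq_subst: "\<Gamma> \<turnstile> s \<^bold>= t \<Longrightarrow> \<Gamma> \<turnstile> inst s \<phi> \<Longrightarrow> \<Gamma> \<turnstile> inst t \<phi>"

text \<open>All free variables of \<open>\<phi>\<close> are below \<open>fv_bound \<phi>\<close>.\<close>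

primrec fv_bound :: "fm \<Rightarrow> nat" where
  "fv_bound (x \<^bold>\<in> y) = max (Suc x) (Suc y)"
| "fv_bound (x \<^bold>= y) = max (Suc x) (Suc y)"
| "fv_bound \<^bold>\<bottom> = 0"
| "fv_bound (\<phi> \<^bold>\<and> \<psi>) = max (fv_bound \<phi>) (fv_bound \<psi>)"
| "fv_bound (\<phi> \<^bold>\<or> \<psi>) = max (fv_bound \<phi>) (fv_bound \<psi>)"
| "fv_bound (\<phi> \<^bold>\<longrightarrow> \<psi>) = max (fv_bound \<phi>) (fv_bound \<psi>)"
| "fv_bound (\<^bold>\<forall> \<phi>) = fv_bound \<phi> - 1"
| "fv_bound (\<^bold>\<exists> \<phi>) = fv_bound \<phi> - 1"

definition univ_closure :: "fm \<Rightarrow> fm"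
  where "univ_closure \<phi> = (Forall ^^ fv_bound \<phi>) \<phi>"

inductive restricted :: "fm \<Rightarrow> bool" where
  "restricted (x \<^bold>\<in> y)"
| "restricted (x \<^bold>= y)"
| "restricted \<^bold>\<bottom>"
| "restricted \<phi> \<Longrightarrow> restricted \<psi> \<Longrightarrow> restricted (\<phi> \<^bold>\<and> \<psi>)"
| "restricted \<phi> \<Longrightarrow> restricted \<psi> \<Longrightarrow> restricted (\<phi> \<^bold>\<or> \<psi>)"
| "restricted \<phi> \<Longrightarrow> restricted \<psi> \<Longrightarrow> restricted (\<phi> \<^bold>\<longrightarrow> \<psi>)"
| "restricted \<phi> \<Longrightarrow> restricted (\<^bold>\<forall>[a] \<phi>)"
| "restricted \<phi> \<Longrightarrow> restricted (\<^bold>\<exists>[a] \<phi>)"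


section \<open>Set-theoretic vocabulary\<close>

definition Subset :: "nat \<Rightarrow> nat \<Rightarrow> fm"  (infix "\<^bold>\<subseteq>" 55)
  where "(a \<^bold>\<subseteq> b) = (\<^bold>\<forall>[a] (0 \<^bold>\<in> Suc b))"

text \<open>\<open>b \<inter> \<alpha>\<close> is inhabited:\<close>

definition meets :: "nat \<Rightarrow> nat \<Rightarrow> fm"
  where "meets b \<alpha> = (\<^bold>\<exists>[b] (0 \<^bold>\<in> Suc \<alpha>))"

definition is_empty :: "nat \<Rightarrow> fm"
  where "is_empty z = (\<^bold>\<forall> (\<^bold>\<not> (0 \<^bold>\<in> Suc z)))"

text \<open>\<open>z = {x, y}\<close>, \<open>z = {x}\<close>, \<open>p = {{x}, {x, y}}\<close> and \<open>y = x \<union> {x}\<close>, respectively:\<close>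

definition is_upair :: "nat \<Rightarrow> nat \<Rightarrow> nat \<Rightarrow> fm"
  where "is_upair z x y = (\<^bold>\<forall> (0 \<^bold>\<in> Suc z \<^bold>\<longleftrightarrow> (0 \<^bold>= Suc x \<^bold>\<or> 0 \<^bold>= Suc y)))"

definition is_sing :: "nat \<Rightarrow> nat \<Rightarrow> fm"
  where "is_sing z x = (\<^bold>\<forall> (0 \<^bold>\<in> Suc z \<^bold>\<longleftrightarrow> 0 \<^bold>= Suc x))"

definition is_pair :: "nat \<Rightarrow> nat \<Rightarrow> nat \<Rightarrow> fm"
  where "is_pair p x y =
    (\<^bold>\<exists> (\<^bold>\<exists> (is_sing 1 (x + 2) \<^bold>\<and> is_upair 0 (x + 2) (y + 2) \<^bold>\<and> is_upair (p + 2) 1 0)))"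

definition is_succ :: "nat \<Rightarrow> nat \<Rightarrow> fm"
  where "is_succ y x = (\<^bold>\<forall> (0 \<^bold>\<in> Suc y \<^bold>\<longleftrightarrow> (0 \<^bold>\<in> Suc x \<^bold>\<or> 0 \<^bold>= Suc x)))"

definition is_inductive :: "nat \<Rightarrow> fm"
  where "is_inductive w =
    ((\<^bold>\<exists>[w] (is_empty 0)) \<^bold>\<and> (\<^bold>\<forall>[w] (\<^bold>\<exists>[Suc w] (is_succ 0 1))))"

text \<open>
  \<open>lift Suc\<close> fixes variable 0 and shifts all others, i.e. it weakens the context of a formula by
  a fresh variable at position 1.
\<close>

definition Exists1 :: "fm \<Rightarrow> fm"  ("\<^bold>\<exists>\<^bold>! _" [50] 50)
  where "(\<^bold>\<exists>\<^bold>! \<phi>) = (\<^bold>\<exists> (\<phi> \<^bold>\<and> (\<^bold>\<forall> (ren (lift Suc) \<phi> \<^bold>\<longrightarrow> 0 \<^bold>= 1))))"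


section \<open>The theory ECST\<close>

definition ax_extensionality :: fm
  where "ax_extensionality = (\<^bold>\<forall> (\<^bold>\<forall> ((\<^bold>\<forall> (0 \<^bold>\<in> 2 \<^bold>\<longleftrightarrow> 0 \<^bold>\<in> 1)) \<^bold>\<longrightarrow> 1 \<^bold>= 0)))"

definition ax_pairing :: fm
  where "ax_pairing = (\<^bold>\<forall> (\<^bold>\<forall> (\<^bold>\<exists> (is_upair 0 2 1))))"

definition ax_union :: fm
  where "ax_union = (\<^bold>\<forall> (\<^bold>\<exists> (\<^bold>\<forall> (0 \<^bold>\<in> 1 \<^bold>\<longleftrightarrow> (\<^bold>\<exists>[2] (1 \<^bold>\<in> 0))))))"

text \<open>
  \<open>\<forall>a. \<exists>b. \<forall>x. x \<in> b \<longleftrightarrow> x \<in> a \<and> \<phi>(x, a, \<dots>)\<close>, where variables 0 and 1 of \<open>\<phi>\<close> are \<open>x\<close> and \<open>a\<close>, and the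
  remaining ones are parameters.
\<close>

definition ax_separation :: "fm \<Rightarrow> fm"
  where "ax_separation \<phi> = (\<^bold>\<forall> (\<^bold>\<exists> (\<^bold>\<forall> (0 \<^bold>\<in> 1 \<^bold>\<longleftrightarrow> (0 \<^bold>\<in> 2 \<^bold>\<and> ren (lift Suc) \<phi>)))))"

text \<open>
  \<open>\<forall>a. (\<forall>x\<in>a. \<exists>!y. \<phi>(y, x, a, \<dots>)) \<longrightarrow> (\<exists>b. \<forall>y. y \<in> b \<longleftrightarrow> (\<exists>x\<in>a. \<phi>(y, x, a, \<dots>)))\<close>, where variables 0, 1
  and 2 of \<open>\<phi>\<close> are \<open>y\<close>, \<open>x\<close> and \<open>a\<close>, and the remaining ones are parameters. The renaming passes
  to the context \<open>x, y, b, a, \<dots>\<close>.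
\<close>

definition ax_replacement :: "fm \<Rightarrow> fm"
  where "ax_replacement \<phi> =
    (\<^bold>\<forall> ((\<^bold>\<forall>[0] (\<^bold>\<exists>\<^bold>! \<phi>)) \<^bold>\<longrightarrow>
       (\<^bold>\<exists> (\<^bold>\<forall> (0 \<^bold>\<in> 1 \<^bold>\<longleftrightarrow>
         (\<^bold>\<exists>[2] (ren (\<lambda>n. if n = 0 then 1 else if n = 1 then 0 else n + 1) \<phi>)))))))"

definition ax_strong_infinity :: fm
  where "ax_strong_infinity = (\<^bold>\<exists> (is_inductive 0 \<^bold>\<and> (\<^bold>\<forall> (is_inductive 0 \<^bold>\<longrightarrow> 1 \<^bold>\<subseteq> 0))))"

definition ECST :: "fm set"
  where "ECST =
    {ax_extensionality, ax_pairing, ax_union, ax_strong_infinity}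
    \<union> {univ_closure (ax_separation \<phi>) |\<phi>. restricted \<phi>}
    \<union> {univ_closure (ax_replacement \<phi>) |\<phi>. True}"


section \<open>Rules and set-generated classes\<close>

text \<open>\<open>r\<close> is a rule, resp. an elementary rule, on \<open>S\<close>:\<close>

definition is_rule :: "nat \<Rightarrow> nat \<Rightarrow> fm"
  where "is_rule r S = (\<^bold>\<exists> (\<^bold>\<exists> (is_pair (r + 2) 1 0 \<^bold>\<and> 1 \<^bold>\<subseteq> (S + 2) \<^bold>\<and> 0 \<^bold>\<subseteq> (S + 2))))"

definition is_elementary_rule :: "nat \<Rightarrow> nat \<Rightarrow> fm"
  where "is_elementary_rule r S =
    (\<^bold>\<exists> (\<^bold>\<exists> (is_pair (r + 2) 1 0 \<^bold>\<and> 1 \<^bold>\<subseteq> (S + 2) \<^bold>\<and> 0 \<^bold>\<subseteq> (S + 2) \<^bold>\<and> (\<^bold>\<exists> (is_sing 2 0)))))"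

definition closed_under :: "nat \<Rightarrow> nat \<Rightarrow> nat \<Rightarrow> fm"
  where "closed_under \<alpha> a b = (a \<^bold>\<subseteq> \<alpha> \<^bold>\<longrightarrow> meets b \<alpha>)"

definition biclosed_under :: "nat \<Rightarrow> nat \<Rightarrow> nat \<Rightarrow> fm"
  where "biclosed_under \<alpha> a b = (meets a \<alpha> \<^bold>\<longleftrightarrow> meets b \<alpha>)"

definition R_closed :: "nat \<Rightarrow> nat \<Rightarrow> fm"
  where "R_closed R \<alpha> = (\<^bold>\<forall>[R] (\<^bold>\<forall> (\<^bold>\<forall> (is_pair 2 1 0 \<^bold>\<longrightarrow> closed_under (\<alpha> + 3) 1 0))))"

definition R_biclosed :: "nat \<Rightarrow> nat \<Rightarrow> fm"
  where "R_biclosed R \<alpha> = (\<^bold>\<forall>[R] (\<^bold>\<forall> (\<^bold>\<forall> (is_pair 2 1 0 \<^bold>\<longrightarrow> biclosed_under (\<alpha> + 3) 1 0))))"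

text \<open>
  A class is given by a formula \<open>\<C>\<close> whose variable 0 is the member and whose remaining variables
  are parameters:
  \<open>\<exists>G. (\<forall>\<beta>\<in>G. \<C>(\<beta>)) \<and> (\<forall>\<alpha>. \<C>(\<alpha>) \<longrightarrow> (\<forall>x\<in>\<alpha>. \<exists>\<beta>\<in>G. x \<in> \<beta> \<and> \<beta> \<subseteq> \<alpha>))\<close>.
\<close>

definition set_generated :: "fm \<Rightarrow> fm"
  where "set_generated \<C> =
    (\<^bold>\<exists> ((\<^bold>\<forall>[0] (ren (lift Suc) \<C>))
       \<^bold>\<and> (\<^bold>\<forall> (ren (lift Suc) \<C> \<^bold>\<longrightarrow> (\<^bold>\<forall>[0] (\<^bold>\<exists>[2] (1 \<^bold>\<in> 0 \<^bold>\<and> 0 \<^bold>\<subseteq> 2)))))))"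

text \<open>
  In both principles \<open>S\<close> and \<open>R\<close> are the variables 1 and 0; inside \<open>set_generated\<close> they are 2 and 1.
\<close>

definition NID_1 :: fm
  where "NID_1 =
    (\<^bold>\<forall> (\<^bold>\<forall> ((\<^bold>\<forall>[0] (is_elementary_rule 0 2)) \<^bold>\<longrightarrow> set_generated (0 \<^bold>\<subseteq> 2 \<^bold>\<and> R_closed 1 0))))"

definition NID_bi :: fm
  where "NID_bi =
    (\<^bold>\<forall> (\<^bold>\<forall> ((\<^bold>\<forall>[0] (is_rule 0 2)) \<^bold>\<longrightarrow> set_generated (0 \<^bold>\<subseteq> 2 \<^bold>\<and> R_biclosed 1 0))))"

end

theory Submission
  imports Defs
begin

text \<open>
  Each of the two notions of closure is an instance of the other, after a change of rules. For an
  elementary rule \<open>({x}, b)\<close>, a subset is closed under it iff it is biclosed under \<open>({x} \<union> b, b)\<close>, because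
  one half of biclosure under the latter rule is automatic. Conversely, a subset is biclosed under
  \<open>(a, b)\<close> iff it is closed under the elementary rules \<open>({x}, b)\<close> for \<open>x \<in> a\<close> and \<open>({y}, a)\<close> for \<open>y \<in> b\<close>. In
  both cases the class of subsets does not change, so a set that generates it for one kind of rule
  generates it for the other (\<open>set_generated_cong\<close>, with \<open>union_rules_biclosed\<close> and
  \<open>singleton_rules_closed\<close>).

  What remains is that the new rules form a set. As \<open>ECST\<close> has no power set axiom, this comes from
  Replacement and Union, in the form that \<open>{z | \<exists>x\<in>a. \<theta>(z, x)}\<close> is a set if all the classes
  \<open>{z | \<theta>(z, x)}\<close> are sets (\<open>is_set_BEx\<close>). Applied to the members of \<open>R\<close>, which are ordered pairs, it
  needs that pairing is injective (\<open>pair_inj\<close>).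

  To argue inside the calculus without handling derivations, derivability from a context is read as
  a forcing relation. The contexts are the extensions of \<open>ECST\<close> with a bound on their free variables,
  ordered by inclusion. Conjunction, implication and the universal quantifier then satisfy the
  clauses of Kripke semantics, with variables as the individuals; a fresh variable is always
  available for the quantifiers. Disjunctions and existential statements are used through elimination
  rules that move to a larger context.
\<close>

section \<open>Renaming of formulas and derivations\<close>

lemma lift_simps [simp]:
  "lift f 0 = 0" "lift f (Suc n) = Suc (f n)"
  by (simp_all add: lift_def)

lemma lift_comp: "lift f \<circ> lift g = lift (f \<circ> g)"
  by (auto simp: lift_def fun_eq_iff split: nat.split)

lemma ren_ren: "ren f (ren g \<phi>) = ren (f \<circ> g) \<phi>"
  by (induction \<phi> arbitrary: f g) (simp_all add: lift_comp)

lemma ren_eqI: "(\<And>n. f n = g n) \<Longrightarrow> ren f \<phi> = ren g \<phi>"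
  by (metis ext)

text \<open>The renaming behind \<^const>\<open>inst\<close>; it reappears under binders, where \<^const>\<open>inst\<close> is pushed
  to \<open>ren (lift (subst0 t))\<close>.\<close>

abbreviation subst0 :: "nat \<Rightarrow> nat \<Rightarrow> nat"
  where "subst0 t \<equiv> case_nat t (\<lambda>m. m)"

lemma ren_cong: "(\<And>n. n < fv_bound \<phi> \<Longrightarrow> f n = g n) \<Longrightarrow> ren f \<phi> = ren g \<phi>"
proof (induction \<phi> arbitrary: f g)
  case (Forall \<phi>)
  have "ren (lift f) \<phi> = ren (lift g) \<phi>"
    by (rule Forall.IH) (use Forall.prems in \<open>auto simp: lift_def split: nat.split\<close>)
  then show ?case by simp
next
  case (Exists \<phi>)
  have "ren (lift f) \<phi> = ren (lift g) \<phi>"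
    by (rule Exists.IH) (use Exists.prems in \<open>auto simp: lift_def split: nat.split\<close>)
  then show ?case by simp
next
  case (And \<phi> \<psi>)
  have "ren f \<phi> = ren g \<phi>" "ren f \<psi> = ren g \<psi>"
    by (rule And.IH, rule And.prems, simp)+
  then show ?case by simp
next
  case (Or \<phi> \<psi>)
  have "ren f \<phi> = ren g \<phi>" "ren f \<psi> = ren g \<psi>"
    by (rule Or.IH, rule Or.prems, simp)+
  then show ?case by simp
next
  case (Imp \<phi> \<psi>)
  have "ren f \<phi> = ren g \<phi>" "ren f \<psi> = ren g \<psi>"
    by (rule Imp.IH, rule Imp.prems, simp)+
  then show ?case by simp
qed auto

lemma lift_id: "lift (\<lambda>n. n) = (\<lambda>n. n)"
  by (auto simp: lift_def fun_eq_iff split: nat.split)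

lemma ren_id: "ren (\<lambda>n. n) \<phi> = \<phi>"
  by (induction \<phi>) (simp_all add: lift_id)

lemma ren_inst: "ren f (inst t \<phi>) = inst (f t) (ren (lift f) \<phi>)"
  unfolding inst_def ren_ren
  by (rule arg_cong[of _ _ "\<lambda>h. ren h \<phi>"]) (auto simp: fun_eq_iff lift_def split: nat.split)

text \<open>Bodies of the form \<open>ren (lift Suc) \<phi>\<close> ignore variable 1, so instantiating variable 1 first has
  no effect.\<close>

lemma inst_subst0_weaken1: "inst z (ren (lift (subst0 b)) (ren (lift Suc) \<phi>)) = inst z \<phi>"
  unfolding inst_def ren_ren by (rule ren_eqI) (auto simp: lift_def split: nat.split)

lemma ren_subst0_weaken1: "ren (lift (subst0 z)) (ren (lift Suc) \<phi>) = \<phi>"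
proof -
  have "ren (lift (subst0 z)) (ren (lift Suc) \<phi>) = ren (\<lambda>n. n) \<phi>"
    unfolding ren_ren by (rule ren_eqI) (simp add: lift_def split: nat.split)
  then show ?thesis by (simp add: ren_id)
qed

text \<open>Two instantiations commute up to the index shift caused by removing the first variable. This is
  what lets a formula \<open>\<theta>(x, z)\<close> be read either as a class of \<open>z\<close> with parameter \<open>x\<close> or the other way round.\<close>

lemma inst_swap: "inst x (ren (lift (subst0 z)) \<theta>) = inst z (inst (Suc x) \<theta>)"
  unfolding inst_def ren_ren by (rule ren_eqI) (simp add: lift_def split: nat.split)

lemma ren_Suc_commute: "ren Suc (ren f \<phi>) = ren (lift f) (ren Suc \<phi>)"
  unfolding ren_ren
  by (rule arg_cong[of _ _ "\<lambda>h. ren h \<phi>"]) (auto simp: fun_eq_iff lift_def)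

lemma derives_ren: "\<Gamma> \<turnstile> \<phi> \<Longrightarrow> ren f ` \<Gamma> \<turnstile> ren f \<phi>"
proof (induction arbitrary: f rule: derives.induct)
  case (orE \<Gamma> \<phi> \<psi> \<chi>)
  show ?case using orE.IH[of f] unfolding ren.simps image_insert by (rule derives.orE)
next
  case (allI \<Gamma> \<phi>)
  have "ren Suc ` ren f ` \<Gamma> \<turnstile> ren (lift f) \<phi>"
    using allI.IH[of "lift f"] by (simp add: image_image ren_Suc_commute)
  then show ?case unfolding ren.simps by (rule derives.allI)
next
  case (allE \<Gamma> \<phi> t)
  show ?case using allE.IH[of f] unfolding ren.simps ren_inst by (rule derives.allE)
next
  case (exI \<Gamma> t \<phi>)
  show ?case using exI.IH[of f] unfolding ren.simps ren_inst by (rule derives.exI)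
next
  case (exE \<Gamma> \<phi> \<psi>)
  have "insert (ren (lift f) \<phi>) (ren Suc ` ren f ` \<Gamma>) \<turnstile> ren Suc (ren f \<psi>)"
    using exE.IH(2)[of "lift f"] by (simp add: image_image ren_Suc_commute)
  with exE.IH(1)[of f] show ?case unfolding ren.simps by (rule derives.exE)
next
  case (eq_subst \<Gamma> s t \<phi>)
  show ?case using eq_subst.IH[of f] unfolding ren.simps ren_inst by (rule derives.eq_subst)
next
  case (botE \<Gamma> \<phi>)
  show ?case using botE.IH[of f] unfolding ren.simps by (rule derives.botE)
next
  case (andE1 \<Gamma> \<phi> \<psi>)
  show ?case using andE1.IH[of f] unfolding ren.simps by (rule derives.andE1)
next
  case (andE2 \<Gamma> \<phi> \<psi>)
  show ?case using andE2.IH[of f] unfolding ren.simps by (rule derives.andE2)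
next
  case (impE \<Gamma> \<phi> \<psi>)
  show ?case using impE.IH[of f] unfolding ren.simps by (rule derives.impE)
next
  case (hyp \<phi> \<Gamma>)
  then show ?case by (intro derives.hyp) auto
next
  case (orI1 \<Gamma> \<phi> \<psi>)
  show ?case using orI1.IH[of f] unfolding ren.simps by (rule derives.orI1)
next
  case (orI2 \<Gamma> \<psi> \<phi>)
  show ?case using orI2.IH[of f] unfolding ren.simps by (rule derives.orI2)
next
  case (andI \<Gamma> \<phi> \<psi>)
  show ?case using andI.IH[of f] unfolding ren.simps by (rule derives.andI)
next
  case (eq_refl \<Gamma> t)
  show ?case unfolding ren.simps by (rule derives.eq_refl)
next
  case (impI \<phi> \<Gamma> \<psi>)
  show ?case using impI.IH[of f] unfolding ren.simps image_insert by (rule derives.impI)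
qed

lemma derives_mono: "\<Gamma> \<turnstile> \<phi> \<Longrightarrow> \<Gamma> \<subseteq> \<Delta> \<Longrightarrow> \<Delta> \<turnstile> \<phi>"
proof (induction arbitrary: \<Delta> rule: derives.induct)
  case (orE \<Gamma> \<phi> \<psi> \<chi>)
  then show ?case by (meson derives.orE insert_mono)
next
  case (impI \<phi> \<Gamma> \<psi>)
  then show ?case by (meson derives.impI insert_mono)
next
  case (allI \<Gamma> \<phi>)
  then show ?case by (meson derives.allI image_mono)
next
  case (exE \<Gamma> \<phi> \<psi>)
  then show ?case by (meson derives.exE image_mono insert_mono)
next
  case (eq_subst \<Gamma> s t \<phi>)
  show ?case using eq_subst.IH[OF eq_subst.prems] by (rule derives.eq_subst)
next
  case (botE \<Gamma> \<phi>)
  show ?case using botE.IH[OF botE.prems] by (rule derives.botE)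
next
  case (andE1 \<Gamma> \<phi> \<psi>)
  show ?case using andE1.IH[OF andE1.prems] by (rule derives.andE1)
next
  case (andE2 \<Gamma> \<phi> \<psi>)
  show ?case using andE2.IH[OF andE2.prems] by (rule derives.andE2)
next
  case (impE \<Gamma> \<phi> \<psi>)
  show ?case using impE.IH[OF impE.prems] by (rule derives.impE)
next
  case (allE \<Gamma> \<phi> t)
  show ?case using allE.IH[OF allE.prems] by (rule derives.allE)
next
  case (exI \<Gamma> t \<phi>)
  show ?case using exI.IH[OF exI.prems] by (rule derives.exI)
next
  case (hyp \<phi> \<Gamma>)
  then show ?case by (intro derives.hyp) auto
next
  case (orI1 \<Gamma> \<phi> \<psi>)
  show ?case using orI1.IH[OF orI1.prems] by (rule derives.orI1)
next
  case (orI2 \<Gamma> \<psi> \<phi>)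
  show ?case using orI2.IH[OF orI2.prems] by (rule derives.orI2)
next
  case (andI \<Gamma> \<phi> \<psi>)
  show ?case using andI.IH[OF andI.prems] by (rule derives.andI)
next
  case (eq_refl \<Gamma> t)
  show ?case by (rule derives.eq_refl)
qed

text \<open>If \<open>N\<close> bounds the free variables of a context, then \<open>N\<close> itself is fresh, and renaming \<open>N\<close> to 0
  (and every other variable up) turns a derivation about the parameter \<open>N\<close> into one about the bound
  variable 0. So a bound on the free variables trades the shifted contexts of the quantifier rules
  for named parameters.\<close>

lemma ren_unfresh:
  obtains f where "\<And>\<phi>. fv_bound \<phi> \<le> Suc N \<Longrightarrow> ren f (inst N \<phi>) = \<phi>"
    and "\<And>\<chi>. fv_bound \<chi> \<le> N \<Longrightarrow> ren f \<chi> = ren Suc \<chi>"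
proof -
  define f where "f n = (if n = N then 0 else Suc n)" for n
  have "ren f (inst N \<phi>) = ren (\<lambda>n. n) \<phi>" if "fv_bound \<phi> \<le> Suc N" for \<phi>
    unfolding inst_def ren_ren
    by (rule ren_cong) (use that in \<open>auto simp: f_def split: nat.split\<close>)
  moreover have "ren f \<chi> = ren Suc \<chi>" if "fv_bound \<chi> \<le> N" for \<chi>
    by (rule ren_cong) (use that in \<open>auto simp: f_def\<close>)
  ultimately show thesis using that[of f] by (simp add: ren_id)
qed

text \<open>The induction peels off the outermost quantifier, so the renaming has to be arbitrary: the
  instance chosen for that quantifier is \<open>f\<close> at 0.\<close>

lemma derives_closure_inst:
  "\<Gamma> \<turnstile> (Forall ^^ n) \<phi> \<Longrightarrow> fv_bound \<phi> \<le> n \<Longrightarrow> \<Gamma> \<turnstile> ren f \<phi>"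
proof (induction n arbitrary: \<phi> f)
  case 0
  then have "ren f \<phi> = ren (\<lambda>n. n) \<phi>" by (intro ren_cong) auto
  then show ?case using 0 by (simp add: ren_id)
next
  case (Suc n)
  then have "\<Gamma> \<turnstile> (Forall ^^ n) (\<^bold>\<forall> \<phi>)" "fv_bound (\<^bold>\<forall> \<phi>) \<le> n" by (simp_all add: funpow_swap1)
  from Suc.IH[OF this, of "f \<circ> Suc"]
  have "\<Gamma> \<turnstile> inst (f 0) (ren (lift (f \<circ> Suc)) \<phi>)" by (metis derives.allE ren.simps(7))
  also have "inst (f 0) (ren (lift (f \<circ> Suc)) \<phi>) = ren f \<phi>"
    unfolding inst_def ren_ren
    by (rule arg_cong[of _ _ "\<lambda>h. ren h \<phi>"]) (auto simp: fun_eq_iff lift_def split: nat.split)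
  finally show ?case .
qed

lemma derives_univ_closure: "\<Gamma> \<turnstile> univ_closure \<phi> \<Longrightarrow> \<Gamma> \<turnstile> \<phi>"
  using derives_closure_inst[of \<Gamma> "fv_bound \<phi>" \<phi> "\<lambda>n. n"] by (simp add: univ_closure_def ren_id)

lemma fv_bound_closure: "fv_bound ((Forall ^^ n) \<phi>) = fv_bound \<phi> - n"
  by (induction n) auto

lemma ECST_closed: "\<phi> \<in> ECST \<Longrightarrow> fv_bound \<phi> = 0"
  by (auto simp: ECST_def univ_closure_def fv_bound_closure ax_extensionality_def ax_pairing_def
      ax_union_def ax_strong_infinity_def is_upair_def is_inductive_def BEx_def BAll_def is_empty_def
      Neg_def Iff_def is_succ_def Subset_def)

section \<open>Derivability as forcing\<close>

text \<open>Contexts whose free variables are bounded always have fresh variables left, and finitely many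
  further hypotheses preserve the bound. Carrying both conditions in a type keeps them out of all
  later statements.\<close>

typedef ctx = "{\<Gamma>. ECST \<subseteq> \<Gamma> \<and> (\<exists>N. \<forall>\<phi>\<in>\<Gamma>. fv_bound \<phi> \<le> N)}"
  by (rule HOL.exI[of _ ECST]) (auto simp: ECST_closed)

definition forces :: "ctx \<Rightarrow> fm \<Rightarrow> bool"  (infix "\<tturnstile>" 25)
  where "(\<Gamma> \<tturnstile> \<phi>) = (Rep_ctx \<Gamma> \<turnstile> \<phi>)"

definition extends :: "ctx \<Rightarrow> ctx \<Rightarrow> bool"  (infix "\<preceq>" 50)
  where "\<Gamma> \<preceq> \<Delta> \<longleftrightarrow> Rep_ctx \<Gamma> \<subseteq> Rep_ctx \<Delta>"

lemma extends_refl [simp, intro!]: "\<Gamma> \<preceq> \<Gamma>"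
  by (simp add: extends_def)

lemma extends_trans [trans]: "\<Gamma> \<preceq> \<Delta> \<Longrightarrow> \<Delta> \<preceq> \<Theta> \<Longrightarrow> \<Gamma> \<preceq> \<Theta>"
  by (auto simp: extends_def)

lemma forces_mono: "\<Gamma> \<preceq> \<Delta> \<Longrightarrow> \<Gamma> \<tturnstile> \<phi> \<Longrightarrow> \<Delta> \<tturnstile> \<phi>"
  unfolding extends_def forces_def by (rule derives_mono)

lemma extend_by:
  obtains \<Delta> where "\<Gamma> \<preceq> \<Delta>" "Rep_ctx \<Delta> = insert \<phi> (Rep_ctx \<Gamma>)"
proof -
  obtain N where "\<forall>\<chi>\<in>Rep_ctx \<Gamma>. fv_bound \<chi> \<le> N" "ECST \<subseteq> Rep_ctx \<Gamma>" using Rep_ctx[of \<Gamma>] by auto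
  then have "ECST \<subseteq> insert \<phi> (Rep_ctx \<Gamma>) \<and> (\<exists>N. \<forall>\<chi>\<in>insert \<phi> (Rep_ctx \<Gamma>). fv_bound \<chi> \<le> N)"
    by (intro conjI HOL.exI[of _ "max N (fv_bound \<phi>)"]) (auto simp: le_max_iff_disj)
  then have "Rep_ctx (Abs_ctx (insert \<phi> (Rep_ctx \<Gamma>))) = insert \<phi> (Rep_ctx \<Gamma>)"
    by (simp add: Abs_ctx_inverse)
  then show thesis by (intro that[of "Abs_ctx (insert \<phi> (Rep_ctx \<Gamma>))"]) (auto simp: extends_def)
qed

text \<open>The following rules say how derivability from a context depends on the parts of a formula.
  Implication refers to all larger contexts, as in a Kripke model; the universal quantifier ranges
  over all variables, since fresh ones are among them. Disjunction and existence are not decided by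
  a context, but whenever the goal is a derivability statement they can be eliminated by passing to
  a larger context.\<close>

lemma forces_And: "(\<Gamma> \<tturnstile> \<phi> \<^bold>\<and> \<psi>) \<longleftrightarrow> (\<Gamma> \<tturnstile> \<phi>) \<and> (\<Gamma> \<tturnstile> \<psi>)"
  unfolding forces_def by (metis derives.andI derives.andE1 derives.andE2)

lemma forces_OrI: "(\<Gamma> \<tturnstile> \<phi>) \<or> (\<Gamma> \<tturnstile> \<psi>) \<Longrightarrow> \<Gamma> \<tturnstile> \<phi> \<^bold>\<or> \<psi>"
  unfolding forces_def by (metis derives.orI1 derives.orI2)

lemma forces_OrI1: "\<Gamma> \<tturnstile> \<phi> \<Longrightarrow> \<Gamma> \<tturnstile> \<phi> \<^bold>\<or> \<psi>" and forces_OrI2: "\<Gamma> \<tturnstile> \<psi> \<Longrightarrow> \<Gamma> \<tturnstile> \<phi> \<^bold>\<or> \<psi>"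
  by (simp_all add: forces_OrI)

lemma forces_OrE:
  assumes "\<Gamma> \<tturnstile> \<phi> \<^bold>\<or> \<psi>"
    and "\<And>\<Delta>. \<Gamma> \<preceq> \<Delta> \<Longrightarrow> \<Delta> \<tturnstile> \<phi> \<Longrightarrow> \<Delta> \<tturnstile> \<chi>" "\<And>\<Delta>. \<Gamma> \<preceq> \<Delta> \<Longrightarrow> \<Delta> \<tturnstile> \<psi> \<Longrightarrow> \<Delta> \<tturnstile> \<chi>"
  shows "\<Gamma> \<tturnstile> \<chi>"
proof -
  have "insert \<phi> (Rep_ctx \<Gamma>) \<turnstile> \<chi>"
    using assms(2) unfolding forces_def by (metis extend_by derives.hyp insertI1)
  moreover have "insert \<psi> (Rep_ctx \<Gamma>) \<turnstile> \<chi>"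
    using assms(3) unfolding forces_def by (metis extend_by derives.hyp insertI1)
  ultimately show ?thesis using assms(1) unfolding forces_def by (metis derives.orE)
qed

lemma forces_Imp: "(\<Gamma> \<tturnstile> \<phi> \<^bold>\<longrightarrow> \<psi>) \<longleftrightarrow> (\<forall>\<Delta>. \<Gamma> \<preceq> \<Delta> \<longrightarrow> (\<Delta> \<tturnstile> \<phi>) \<longrightarrow> (\<Delta> \<tturnstile> \<psi>))"
proof
  assume "\<Gamma> \<tturnstile> \<phi> \<^bold>\<longrightarrow> \<psi>"
  then show "\<forall>\<Delta>. \<Gamma> \<preceq> \<Delta> \<longrightarrow> (\<Delta> \<tturnstile> \<phi>) \<longrightarrow> (\<Delta> \<tturnstile> \<psi>)"
    by (metis forces_def forces_mono derives.impE)
next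
  assume *: "\<forall>\<Delta>. \<Gamma> \<preceq> \<Delta> \<longrightarrow> (\<Delta> \<tturnstile> \<phi>) \<longrightarrow> (\<Delta> \<tturnstile> \<psi>)"
  obtain \<Delta> where "\<Gamma> \<preceq> \<Delta>" "Rep_ctx \<Delta> = insert \<phi> (Rep_ctx \<Gamma>)" by (rule extend_by)
  with * show "\<Gamma> \<tturnstile> \<phi> \<^bold>\<longrightarrow> \<psi>" by (metis forces_def derives.hyp derives.impI insertI1)
qed

lemma forces_Iff: "(\<Gamma> \<tturnstile> \<phi> \<^bold>\<longleftrightarrow> \<psi>) \<longleftrightarrow> (\<forall>\<Delta>. \<Gamma> \<preceq> \<Delta> \<longrightarrow> (\<Delta> \<tturnstile> \<phi>) = (\<Delta> \<tturnstile> \<psi>))"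
  unfolding Iff_def forces_And forces_Imp by blast

lemma forces_Forall: "(\<Gamma> \<tturnstile> \<^bold>\<forall> \<phi>) \<longleftrightarrow> (\<forall>x. \<Gamma> \<tturnstile> inst x \<phi>)"
proof
  assume "\<Gamma> \<tturnstile> \<^bold>\<forall> \<phi>"
  then show "\<forall>x. \<Gamma> \<tturnstile> inst x \<phi>" unfolding forces_def by (blast intro: derives.allE)
next
  assume *: "\<forall>x. \<Gamma> \<tturnstile> inst x \<phi>"
  obtain M where M: "\<forall>\<chi>\<in>Rep_ctx \<Gamma>. fv_bound \<chi> \<le> M" using Rep_ctx[of \<Gamma>] by auto
  define N where "N = max M (fv_bound \<phi>)"
  obtain f where f: "\<And>\<phi>. fv_bound \<phi> \<le> Suc N \<Longrightarrow> ren f (inst N \<phi>) = \<phi>"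
    "\<And>\<chi>. fv_bound \<chi> \<le> N \<Longrightarrow> ren f \<chi> = ren Suc \<chi>"
    using ren_unfresh by blast
  have "ren f \<chi> = ren Suc \<chi>" if "\<chi> \<in> Rep_ctx \<Gamma>" for \<chi>
    by (rule f) (use M that in \<open>auto simp: N_def le_max_iff_disj\<close>)
  moreover have "ren f (inst N \<phi>) = \<phi>" by (rule f) (simp add: N_def)
  ultimately have "ren Suc ` Rep_ctx \<Gamma> \<turnstile> \<phi>"
    using derives_ren[of "Rep_ctx \<Gamma>" "inst N \<phi>" f] * by (simp add: forces_def cong: image_cong)
  then show "\<Gamma> \<tturnstile> \<^bold>\<forall> \<phi>" unfolding forces_def by (rule derives.allI)
qed

lemma forces_ExistsI: "\<Gamma> \<tturnstile> inst x \<phi> \<Longrightarrow> \<Gamma> \<tturnstile> \<^bold>\<exists> \<phi>"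
  unfolding forces_def by (rule derives.exI)

lemma forces_ExistsE:
  assumes "\<Gamma> \<tturnstile> \<^bold>\<exists> \<phi>" and step: "\<And>\<Delta> x. \<Gamma> \<preceq> \<Delta> \<Longrightarrow> \<Delta> \<tturnstile> inst x \<phi> \<Longrightarrow> \<Delta> \<tturnstile> \<psi>"
  shows "\<Gamma> \<tturnstile> \<psi>"
proof -
  obtain M where M: "\<forall>\<chi>\<in>Rep_ctx \<Gamma>. fv_bound \<chi> \<le> M" using Rep_ctx[of \<Gamma>] by auto
  define N where "N = max M (max (fv_bound \<phi>) (fv_bound \<psi>))"
  obtain f where f: "\<And>\<phi>. fv_bound \<phi> \<le> Suc N \<Longrightarrow> ren f (inst N \<phi>) = \<phi>"
    "\<And>\<chi>. fv_bound \<chi> \<le> N \<Longrightarrow> ren f \<chi> = ren Suc \<chi>"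
    using ren_unfresh by blast
  obtain \<Delta> where "\<Gamma> \<preceq> \<Delta>" "Rep_ctx \<Delta> = insert (inst N \<phi>) (Rep_ctx \<Gamma>)" by (rule extend_by)
  then have "insert (inst N \<phi>) (Rep_ctx \<Gamma>) \<turnstile> \<psi>"
    using step[of \<Delta> N] unfolding forces_def by (metis derives.hyp insertI1)
  then have "ren f ` insert (inst N \<phi>) (Rep_ctx \<Gamma>) \<turnstile> ren f \<psi>" by (rule derives_ren)
  moreover have "ren f \<chi> = ren Suc \<chi>" if "\<chi> \<in> Rep_ctx \<Gamma>" for \<chi>
    by (rule f) (use M that in \<open>auto simp: N_def le_max_iff_disj\<close>)
  moreover have "ren f (inst N \<phi>) = \<phi>" by (rule f) (simp add: N_def)
  moreover have "ren f \<psi> = ren Suc \<psi>" by (rule f) (simp add: N_def)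
  ultimately have "insert \<phi> (ren Suc ` Rep_ctx \<Gamma>) \<turnstile> ren Suc \<psi>" by (simp cong: image_cong)
  then show ?thesis using assms(1) unfolding forces_def by (rule derives.exE[rotated])
qed

lemma ECST_forces: "\<phi> \<in> ECST \<Longrightarrow> \<Gamma> \<tturnstile> \<phi>"
  using Rep_ctx[of \<Gamma>] unfolding forces_def by (auto intro: derives.hyp)

lemma ECST_forces_closure: "univ_closure \<phi> \<in> ECST \<Longrightarrow> \<Gamma> \<tturnstile> \<phi>"
  using ECST_forces[of "univ_closure \<phi>" \<Gamma>] unfolding forces_def by (rule derives_univ_closure)

lemma forces_subst: "\<Gamma> \<tturnstile> s \<^bold>= t \<Longrightarrow> \<Gamma> \<tturnstile> inst s \<phi> \<Longrightarrow> \<Gamma> \<tturnstile> inst t \<phi>"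
  unfolding forces_def by (rule derives.eq_subst)

lemma forces_refl [simp, intro!]: "\<Gamma> \<tturnstile> t \<^bold>= t"
  unfolding forces_def by (rule derives.eq_refl)

lemma forces_sym: "\<Gamma> \<tturnstile> s \<^bold>= t \<Longrightarrow> \<Gamma> \<tturnstile> t \<^bold>= s"
  using forces_subst[of \<Gamma> s t "0 \<^bold>= Suc s"] by (simp add: inst_def)

lemma forces_cong: "\<Gamma> \<tturnstile> s \<^bold>= t \<Longrightarrow> (\<Gamma> \<tturnstile> inst s \<phi>) = (\<Gamma> \<tturnstile> inst t \<phi>)"
  using forces_subst forces_sym by blast

section \<open>Set-theoretic vocabulary\<close>

lemma Iff_ren [simp]: "ren f (\<phi> \<^bold>\<longleftrightarrow> \<psi>) = (ren f \<phi> \<^bold>\<longleftrightarrow> ren f \<psi>)"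
  by (simp add: Iff_def)

lemma BAll_ren [simp]: "ren f (\<^bold>\<forall>[a] \<phi>) = (\<^bold>\<forall>[f a] (ren (lift f) \<phi>))"
  by (simp add: BAll_def)

lemma BEx_ren [simp]: "ren f (\<^bold>\<exists>[a] \<phi>) = (\<^bold>\<exists>[f a] (ren (lift f) \<phi>))"
  by (simp add: BEx_def)

lemma Subset_ren [simp]: "ren f (a \<^bold>\<subseteq> b) = (f a \<^bold>\<subseteq> f b)"
  by (simp add: Subset_def)

lemma meets_ren [simp]: "ren f (meets a b) = meets (f a) (f b)"
  by (simp add: meets_def)

lemma is_sing_ren [simp]: "ren f (is_sing z x) = is_sing (f z) (f x)"
  by (simp add: is_sing_def)

lemma is_upair_ren [simp]: "ren f (is_upair z x y) = is_upair (f z) (f x) (f y)"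
  by (simp add: is_upair_def)

lemma is_pair_ren [simp]: "ren f (is_pair p x y) = is_pair (f p) (f x) (f y)"
  by (simp add: is_pair_def numeral_eq_Suc)

lemma closed_under_ren [simp]: "ren f (closed_under \<alpha> a b) = closed_under (f \<alpha>) (f a) (f b)"
  by (simp add: closed_under_def)

lemma biclosed_under_ren [simp]: "ren f (biclosed_under \<alpha> a b) = biclosed_under (f \<alpha>) (f a) (f b)"
  by (simp add: biclosed_under_def)

lemma R_closed_ren [simp]: "ren f (R_closed R \<alpha>) = R_closed (f R) (f \<alpha>)"
  by (simp add: R_closed_def numeral_eq_Suc)

lemma R_biclosed_ren [simp]: "ren f (R_biclosed R \<alpha>) = R_biclosed (f R) (f \<alpha>)"
  by (simp add: R_biclosed_def numeral_eq_Suc)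

lemma is_rule_ren [simp]: "ren f (is_rule r S) = is_rule (f r) (f S)"
  by (simp add: is_rule_def numeral_eq_Suc)

lemma is_elementary_rule_ren [simp]: "ren f (is_elementary_rule r S) = is_elementary_rule (f r) (f S)"
  by (simp add: is_elementary_rule_def numeral_eq_Suc)

lemma forces_BAll:
  "(\<Gamma> \<tturnstile> \<^bold>\<forall>[a] \<phi>) \<longleftrightarrow> (\<forall>\<Delta> x. \<Gamma> \<preceq> \<Delta> \<longrightarrow> (\<Delta> \<tturnstile> x \<^bold>\<in> a) \<longrightarrow> (\<Delta> \<tturnstile> inst x \<phi>))"
proof -
  have "(\<Gamma> \<tturnstile> \<^bold>\<forall>[a] \<phi>) \<longleftrightarrow> (\<forall>x. \<Gamma> \<tturnstile> inst x (0 \<^bold>\<in> Suc a \<^bold>\<longrightarrow> \<phi>))"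
    by (simp add: BAll_def forces_Forall)
  also have "\<dots> \<longleftrightarrow> (\<forall>x. \<Gamma> \<tturnstile> x \<^bold>\<in> a \<^bold>\<longrightarrow> inst x \<phi>)" by (simp add: inst_def)
  finally show ?thesis by (auto simp: forces_Imp)
qed

lemma forces_BExI: "\<Gamma> \<tturnstile> x \<^bold>\<in> a \<Longrightarrow> \<Gamma> \<tturnstile> inst x \<phi> \<Longrightarrow> \<Gamma> \<tturnstile> \<^bold>\<exists>[a] \<phi>"
  unfolding BEx_def by (rule forces_ExistsI[of _ x]) (simp add: inst_def forces_And)

lemma forces_BExE:
  assumes "\<Gamma> \<tturnstile> \<^bold>\<exists>[a] \<phi>"
    and "\<And>\<Delta> x. \<Gamma> \<preceq> \<Delta> \<Longrightarrow> \<Delta> \<tturnstile> x \<^bold>\<in> a \<Longrightarrow> \<Delta> \<tturnstile> inst x \<phi> \<Longrightarrow> \<Delta> \<tturnstile> \<psi>"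
  shows "\<Gamma> \<tturnstile> \<psi>"
  using assms(1) unfolding BEx_def
  by (rule forces_ExistsE) (use assms(2) in \<open>auto simp: inst_def forces_And\<close>)

lemma forces_Subset: "(\<Gamma> \<tturnstile> a \<^bold>\<subseteq> b) \<longleftrightarrow> (\<forall>\<Delta> x. \<Gamma> \<preceq> \<Delta> \<longrightarrow> (\<Delta> \<tturnstile> x \<^bold>\<in> a) \<longrightarrow> (\<Delta> \<tturnstile> x \<^bold>\<in> b))"
  by (simp add: Subset_def forces_BAll inst_def)

lemma Subset_mem: "\<Gamma> \<tturnstile> a \<^bold>\<subseteq> b \<Longrightarrow> \<Gamma> \<tturnstile> x \<^bold>\<in> a \<Longrightarrow> \<Gamma> \<tturnstile> x \<^bold>\<in> b"
  by (auto simp: forces_Subset)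

lemma forces_meetsI: "\<Gamma> \<tturnstile> x \<^bold>\<in> a \<Longrightarrow> \<Gamma> \<tturnstile> x \<^bold>\<in> b \<Longrightarrow> \<Gamma> \<tturnstile> meets a b"
  unfolding meets_def by (rule forces_BExI) (simp_all add: inst_def)

lemma forces_meetsE:
  assumes "\<Gamma> \<tturnstile> meets a b"
    and "\<And>\<Delta> x. \<Gamma> \<preceq> \<Delta> \<Longrightarrow> \<Delta> \<tturnstile> x \<^bold>\<in> a \<Longrightarrow> \<Delta> \<tturnstile> x \<^bold>\<in> b \<Longrightarrow> \<Delta> \<tturnstile> \<psi>"
  shows "\<Gamma> \<tturnstile> \<psi>"
  using assms(1) unfolding meets_def
  by (rule forces_BExE) (use assms(2) in \<open>simp add: inst_def\<close>)

lemma forces_ext: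
  assumes "\<And>\<Delta> x. \<Gamma> \<preceq> \<Delta> \<Longrightarrow> (\<Delta> \<tturnstile> x \<^bold>\<in> a) = (\<Delta> \<tturnstile> x \<^bold>\<in> b)"
  shows "\<Gamma> \<tturnstile> a \<^bold>= b"
proof -
  have "\<Gamma> \<tturnstile> ax_extensionality" by (rule ECST_forces) (simp add: ECST_def)
  then have "\<Gamma> \<tturnstile> (\<^bold>\<forall> (0 \<^bold>\<in> Suc a \<^bold>\<longleftrightarrow> 0 \<^bold>\<in> Suc b)) \<^bold>\<longrightarrow> a \<^bold>= b"
    by (simp add: ax_extensionality_def forces_Forall inst_def numeral_eq_Suc)
  then show ?thesis
    using assms by (simp add: inst_def forces_Forall forces_Iff forces_Imp)
qed

lemma forces_cong_mem:
  assumes "\<Gamma> \<tturnstile> a \<^bold>= b"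
  shows "(\<Gamma> \<tturnstile> a \<^bold>\<in> c) = (\<Gamma> \<tturnstile> b \<^bold>\<in> c)" "(\<Gamma> \<tturnstile> c \<^bold>\<in> a) = (\<Gamma> \<tturnstile> c \<^bold>\<in> b)"
    "(\<Gamma> \<tturnstile> meets a c) = (\<Gamma> \<tturnstile> meets b c)" "(\<Gamma> \<tturnstile> a \<^bold>\<subseteq> c) = (\<Gamma> \<tturnstile> b \<^bold>\<subseteq> c)"
    "(\<Gamma> \<tturnstile> a \<^bold>= c) = (\<Gamma> \<tturnstile> b \<^bold>= c)" "(\<Gamma> \<tturnstile> c \<^bold>= a) = (\<Gamma> \<tturnstile> c \<^bold>= b)"
  using forces_cong[OF assms, of "0 \<^bold>\<in> Suc c"] forces_cong[OF assms, of "Suc c \<^bold>\<in> 0"]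
    forces_cong[OF assms, of "meets 0 (Suc c)"] forces_cong[OF assms, of "0 \<^bold>\<subseteq> Suc c"]
    forces_cong[OF assms, of "0 \<^bold>= Suc c"] forces_cong[OF assms, of "Suc c \<^bold>= 0"]
  by (simp_all add: inst_def)

lemma forces_cong_pair:
  assumes "\<Gamma> \<tturnstile> a \<^bold>= b"
  shows "(\<Gamma> \<tturnstile> is_pair a c d) = (\<Gamma> \<tturnstile> is_pair b c d)" "(\<Gamma> \<tturnstile> is_pair c a d) = (\<Gamma> \<tturnstile> is_pair c b d)"
    "(\<Gamma> \<tturnstile> is_pair c d a) = (\<Gamma> \<tturnstile> is_pair c d b)"
  using forces_cong[OF assms, of "is_pair 0 (Suc c) (Suc d)"]
    forces_cong[OF assms, of "is_pair (Suc c) 0 (Suc d)"] forces_cong[OF assms, of "is_pair (Suc c) (Suc d) 0"]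
  by (simp_all add: inst_def)

lemma forces_sing: "(\<Gamma> \<tturnstile> is_sing u x) \<longleftrightarrow> (\<forall>\<Delta> y. \<Gamma> \<preceq> \<Delta> \<longrightarrow> (\<Delta> \<tturnstile> y \<^bold>\<in> u) = (\<Delta> \<tturnstile> y \<^bold>= x))"
  by (auto simp: is_sing_def forces_Forall forces_Iff inst_def)

lemma forces_upair:
  "(\<Gamma> \<tturnstile> is_upair u x x') \<longleftrightarrow> (\<forall>\<Delta> y. \<Gamma> \<preceq> \<Delta> \<longrightarrow> (\<Delta> \<tturnstile> y \<^bold>\<in> u) = (\<Delta> \<tturnstile> y \<^bold>= x \<^bold>\<or> y \<^bold>= x'))"
  by (auto simp: is_upair_def forces_Forall forces_Iff inst_def)

lemma pairI: "\<Gamma> \<tturnstile> is_sing u x \<Longrightarrow> \<Gamma> \<tturnstile> is_upair v x y \<Longrightarrow> \<Gamma> \<tturnstile> is_upair p u v \<Longrightarrow> \<Gamma> \<tturnstile> is_pair p x y"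
  unfolding is_pair_def
  by (rule forces_ExistsI[of _ u], simp add: inst_def, rule forces_ExistsI[of _ v])
    (simp add: inst_def forces_And numeral_eq_Suc)

lemma pairE:
  assumes "\<Gamma> \<tturnstile> is_pair p x y"
    and *: "\<And>\<Delta> u v. \<Gamma> \<preceq> \<Delta> \<Longrightarrow> \<Delta> \<tturnstile> is_sing u x \<Longrightarrow> \<Delta> \<tturnstile> is_upair v x y \<Longrightarrow> \<Delta> \<tturnstile> is_upair p u v \<Longrightarrow> \<Delta> \<tturnstile> \<psi>"
  shows "\<Gamma> \<tturnstile> \<psi>"
  using assms(1) unfolding is_pair_def
proof (rule forces_ExistsE)
  fix \<Delta> u assume "\<Gamma> \<preceq> \<Delta>"
    "\<Delta> \<tturnstile> inst u (\<^bold>\<exists> (is_sing 1 (x + 2) \<^bold>\<and> is_upair 0 (x + 2) (y + 2) \<^bold>\<and> is_upair (p + 2) 1 0))"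
  then show "\<Delta> \<tturnstile> \<psi>"
    by (auto simp: inst_def numeral_eq_Suc forces_And elim!: forces_ExistsE intro: * extends_trans)
qed

section \<open>Classes that are sets\<close>

text \<open>The class \<open>{z | \<phi>(z)}\<close>, with \<open>z\<close> as variable 0 and the parameters above it, is a set.\<close>

definition is_set :: "fm \<Rightarrow> fm"
  where "is_set \<phi> = (\<^bold>\<exists> (\<^bold>\<forall> (0 \<^bold>\<in> 1 \<^bold>\<longleftrightarrow> ren (lift Suc) \<phi>)))"

text \<open>\<open>b = {z | \<phi>(z)}\<close>, read off from membership in all larger contexts.\<close>

definition collects :: "ctx \<Rightarrow> nat \<Rightarrow> fm \<Rightarrow> bool"
  where "collects \<Gamma> b \<phi> \<longleftrightarrow> (\<forall>\<Delta> z. \<Gamma> \<preceq> \<Delta> \<longrightarrow> (\<Delta> \<tturnstile> z \<^bold>\<in> b) = (\<Delta> \<tturnstile> inst z \<phi>))"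

lemma collects_iff: "collects \<Gamma> b \<phi> \<longleftrightarrow> (\<Gamma> \<tturnstile> inst b (\<^bold>\<forall> (0 \<^bold>\<in> 1 \<^bold>\<longleftrightarrow> ren (lift Suc) \<phi>)))"
proof -
  have "inst b (\<^bold>\<forall> (0 \<^bold>\<in> 1 \<^bold>\<longleftrightarrow> ren (lift Suc) \<phi>)) =
    (\<^bold>\<forall> (0 \<^bold>\<in> Suc b \<^bold>\<longleftrightarrow> ren (lift (subst0 b)) (ren (lift Suc) \<phi>)))"
    by (simp add: inst_def)
  moreover have "inst z (0 \<^bold>\<in> Suc b \<^bold>\<longleftrightarrow> ren (lift (subst0 b)) (ren (lift Suc) \<phi>)) = (z \<^bold>\<in> b \<^bold>\<longleftrightarrow> inst z \<phi>)" for z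
    by (subst inst_subst0_weaken1[of z b, symmetric]) (simp add: inst_def)
  ultimately show ?thesis by (auto simp: collects_def forces_Forall forces_Iff)
qed

lemma collects_mono: "\<Gamma> \<preceq> \<Delta> \<Longrightarrow> collects \<Gamma> b \<phi> \<Longrightarrow> collects \<Delta> b \<phi>"
  by (auto simp: collects_iff intro: forces_mono)

lemma is_setI: "collects \<Gamma> b \<phi> \<Longrightarrow> \<Gamma> \<tturnstile> is_set \<phi>"
  unfolding is_set_def collects_iff by (rule forces_ExistsI)

lemma is_setE:
  assumes "\<Gamma> \<tturnstile> is_set \<phi>" and "\<And>\<Delta> b. \<Gamma> \<preceq> \<Delta> \<Longrightarrow> collects \<Delta> b \<phi> \<Longrightarrow> \<Delta> \<tturnstile> \<psi>"
  shows "\<Gamma> \<tturnstile> \<psi>"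
  using assms unfolding is_set_def collects_iff by (rule forces_ExistsE)

lemma collects_mem: "collects \<Gamma> u \<phi> \<Longrightarrow> (\<Gamma> \<tturnstile> z \<^bold>\<in> u) = (\<Gamma> \<tturnstile> inst z \<phi>)"
  by (simp add: collects_def)

lemma is_set_mem: "\<Gamma> \<tturnstile> is_set (0 \<^bold>\<in> Suc a)"
  by (rule is_setI[of _ a]) (simp add: collects_def inst_def)

lemma collects_unique: "collects \<Gamma> b \<phi> \<Longrightarrow> collects \<Gamma> c \<phi> \<Longrightarrow> \<Gamma> \<tturnstile> b \<^bold>= c"
  by (rule forces_ext) (simp add: collects_def)

lemma is_set_cong:
  assumes "\<Gamma> \<tturnstile> is_set \<phi>" "\<And>\<Delta> z. \<Gamma> \<preceq> \<Delta> \<Longrightarrow> (\<Delta> \<tturnstile> inst z \<phi>) = (\<Delta> \<tturnstile> inst z \<psi>)"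
  shows "\<Gamma> \<tturnstile> is_set \<psi>"
  using assms(1)
proof (rule is_setE)
  fix \<Delta> b assume "\<Gamma> \<preceq> \<Delta>" "collects \<Delta> b \<phi>"
  then have "collects \<Delta> b \<psi>" using assms(2) by (meson collects_def extends_trans)
  then show "\<Delta> \<tturnstile> is_set \<psi>" by (rule is_setI)
qed

lemma is_set_upair: "\<Gamma> \<tturnstile> is_set (0 \<^bold>= Suc x \<^bold>\<or> 0 \<^bold>= Suc y)"
proof -
  have "\<Gamma> \<tturnstile> ax_pairing" by (rule ECST_forces) (simp add: ECST_def)
  then show ?thesis
    by (simp add: ax_pairing_def is_set_def is_upair_def forces_Forall inst_def numeral_eq_Suc)
qed

lemma is_set_sing: "\<Gamma> \<tturnstile> is_set (0 \<^bold>= Suc x)"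
  by (rule is_set_cong[OF is_set_upair[of _ x x]]) (auto simp: inst_def intro: forces_OrI elim: forces_OrE)

lemma is_set_Union: "\<Gamma> \<tturnstile> is_set (\<^bold>\<exists>[Suc a] (1 \<^bold>\<in> 0))"
proof -
  have "\<Gamma> \<tturnstile> ax_union" by (rule ECST_forces) (simp add: ECST_def)
  then show ?thesis
    by (simp add: ax_union_def is_set_def forces_Forall inst_def numeral_eq_Suc)
qed

lemma collects_sing: "collects \<Gamma> b (0 \<^bold>= Suc x) \<longleftrightarrow> (\<Gamma> \<tturnstile> is_sing b x)"
  by (simp add: collects_def forces_sing inst_def)

lemma collects_upair: "collects \<Gamma> b (0 \<^bold>= Suc x \<^bold>\<or> 0 \<^bold>= Suc y) \<longleftrightarrow> (\<Gamma> \<tturnstile> is_upair b x y)"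
  by (simp add: collects_def forces_upair inst_def)

lemma pair_exists:
  assumes "\<And>\<Delta> p. \<Gamma> \<preceq> \<Delta> \<Longrightarrow> \<Delta> \<tturnstile> is_pair p x y \<Longrightarrow> \<Delta> \<tturnstile> \<psi>"
  shows "\<Gamma> \<tturnstile> \<psi>"
proof (rule is_setE[OF is_set_sing[of \<Gamma> x]], unfold collects_sing)
  fix \<Delta> u assume u: "\<Gamma> \<preceq> \<Delta>" "\<Delta> \<tturnstile> is_sing u x"
  show "\<Delta> \<tturnstile> \<psi>"
  proof (rule is_setE[OF is_set_upair[of \<Delta> x y]], unfold collects_upair)
    fix \<Theta> v assume v: "\<Delta> \<preceq> \<Theta>" "\<Theta> \<tturnstile> is_upair v x y"
    show "\<Theta> \<tturnstile> \<psi>"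
    proof (rule is_setE[OF is_set_upair[of \<Theta> u v]], unfold collects_upair)
      fix \<Lambda> p assume p: "\<Theta> \<preceq> \<Lambda>" "\<Lambda> \<tturnstile> is_upair p u v"
      have "\<Lambda> \<tturnstile> is_pair p x y"
        by (rule pairI[OF _ _ p(2)]) (meson u v p forces_mono extends_trans)+
      with assms show "\<Lambda> \<tturnstile> \<psi>" by (meson u v p extends_trans)
    qed
  qed
qed

lemma sing_mem: "\<Gamma> \<tturnstile> is_sing u x \<Longrightarrow> (\<Gamma> \<tturnstile> y \<^bold>\<in> u) = (\<Gamma> \<tturnstile> y \<^bold>= x)"
  by (simp add: forces_sing)

lemma upair_mem: "\<Gamma> \<tturnstile> is_upair u x x' \<Longrightarrow> (\<Gamma> \<tturnstile> y \<^bold>\<in> u) = (\<Gamma> \<tturnstile> y \<^bold>= x \<^bold>\<or> y \<^bold>= x')"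
  by (simp add: forces_upair)

section \<open>Ordered pairs\<close>

text \<open>A constructive form of the argument for Kuratowski pairs: \<open>{a} \<in> {{c}, {c, d}}\<close> makes \<open>{a}\<close>
  equal to a set that contains \<open>c\<close>, and \<open>{a, b} \<in> {{c}, {c, d}}\<close> puts \<open>b\<close> into \<open>{c}\<close> or \<open>{c, d}\<close>.\<close>

lemma pair_inj_half:
  assumes "\<Gamma> \<tturnstile> is_sing u a" "\<Gamma> \<tturnstile> is_upair v a b" "\<Gamma> \<tturnstile> is_upair p u v"
    and "\<Gamma> \<tturnstile> is_sing u' c" "\<Gamma> \<tturnstile> is_upair v' c d" "\<Gamma> \<tturnstile> is_upair p u' v'"
  shows "\<Gamma> \<tturnstile> a \<^bold>= c" "\<Gamma> \<tturnstile> b \<^bold>= c \<^bold>\<or> b \<^bold>= d"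
proof -
  have "\<Gamma> \<tturnstile> u \<^bold>\<in> p" using assms(3) by (simp add: upair_mem forces_OrI1)
  then have "\<Gamma> \<tturnstile> u \<^bold>= u' \<^bold>\<or> u \<^bold>= v'" using assms(6) by (simp add: upair_mem)
  then show "\<Gamma> \<tturnstile> a \<^bold>= c"
  proof (rule forces_OrE)
    fix \<Delta> assume le: "\<Gamma> \<preceq> \<Delta>" and eq: "\<Delta> \<tturnstile> u \<^bold>= u'"
    note F = assms[THEN forces_mono[OF le]]
    have "\<Delta> \<tturnstile> c \<^bold>\<in> u'" using F(4) by (simp add: sing_mem)
    then have "\<Delta> \<tturnstile> c \<^bold>\<in> u" using forces_cong_mem(2)[OF eq] by simp
    then show "\<Delta> \<tturnstile> a \<^bold>= c" using F(1) by (simp add: sing_mem forces_sym)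
  next
    fix \<Delta> assume le: "\<Gamma> \<preceq> \<Delta>" and eq: "\<Delta> \<tturnstile> u \<^bold>= v'"
    note F = assms[THEN forces_mono[OF le]]
    have "\<Delta> \<tturnstile> c \<^bold>\<in> v'" using F(5) by (simp add: upair_mem forces_OrI1)
    then have "\<Delta> \<tturnstile> c \<^bold>\<in> u" using forces_cong_mem(2)[OF eq] by simp
    then show "\<Delta> \<tturnstile> a \<^bold>= c" using F(1) by (simp add: sing_mem forces_sym)
  qed
  have b: "\<Gamma> \<tturnstile> b \<^bold>\<in> v" using assms(2) by (simp add: upair_mem forces_OrI2)
  have "\<Gamma> \<tturnstile> v \<^bold>\<in> p" using assms(3) by (simp add: upair_mem forces_OrI2)
  then have "\<Gamma> \<tturnstile> v \<^bold>= u' \<^bold>\<or> v \<^bold>= v'" using assms(6) by (simp add: upair_mem)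
  then show "\<Gamma> \<tturnstile> b \<^bold>= c \<^bold>\<or> b \<^bold>= d"
  proof (rule forces_OrE)
    fix \<Delta> assume le: "\<Gamma> \<preceq> \<Delta>" and eq: "\<Delta> \<tturnstile> v \<^bold>= u'"
    show "\<Delta> \<tturnstile> b \<^bold>= c \<^bold>\<or> b \<^bold>= d"
      using b assms(4) forces_cong_mem(2)[OF eq] le by (metis forces_OrI1 forces_mono sing_mem)
  next
    fix \<Delta> assume le: "\<Gamma> \<preceq> \<Delta>" and eq: "\<Delta> \<tturnstile> v \<^bold>= v'"
    show "\<Delta> \<tturnstile> b \<^bold>= c \<^bold>\<or> b \<^bold>= d"
      using b assms(5) forces_cong_mem(2)[OF eq] le by (metis forces_mono upair_mem)
  qed
qed

text \<open>By the previous lemma in both directions, \<open>a = c\<close>, \<open>b\<close> is \<open>c\<close> or \<open>d\<close>, and \<open>d\<close> is \<open>a\<close> or \<open>b\<close>. The only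
  combination that does not state \<open>b = d\<close> is \<open>b = c\<close>, \<open>d = a\<close>, and there \<open>b = c = a = d\<close>.\<close>

lemma pair_inj:
  assumes "\<Gamma> \<tturnstile> is_pair p a b" "\<Gamma> \<tturnstile> is_pair p c d"
  shows "\<Gamma> \<tturnstile> a \<^bold>= c" "\<Gamma> \<tturnstile> b \<^bold>= d"
proof -
  have "\<Gamma> \<tturnstile> a \<^bold>= c \<^bold>\<and> b \<^bold>= d"
    using assms(1)
  proof (rule pairE)
    fix \<Delta> u v
    assume le: "\<Gamma> \<preceq> \<Delta>" and "\<Delta> \<tturnstile> is_sing u a" "\<Delta> \<tturnstile> is_upair v a b" "\<Delta> \<tturnstile> is_upair p u v"
    note 1 = this(2-)
    show "\<Delta> \<tturnstile> a \<^bold>= c \<^bold>\<and> b \<^bold>= d"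
      using forces_mono[OF le assms(2)]
    proof (rule pairE)
      fix \<Theta> u' v'
      assume le: "\<Delta> \<preceq> \<Theta>" and 2: "\<Theta> \<tturnstile> is_sing u' c" "\<Theta> \<tturnstile> is_upair v' c d" "\<Theta> \<tturnstile> is_upair p u' v'"
      note 1 = 1[THEN forces_mono[OF le]]
      have ac: "\<Theta> \<tturnstile> a \<^bold>= c" and b: "\<Theta> \<tturnstile> b \<^bold>= c \<^bold>\<or> b \<^bold>= d" and d: "\<Theta> \<tturnstile> d \<^bold>= a \<^bold>\<or> d \<^bold>= b"
        using pair_inj_half[OF 1 2] pair_inj_half[OF 2 1] by simp_all
      have "\<Theta> \<tturnstile> b \<^bold>= d"
        using d
      proof (rule forces_OrE)
        fix \<Lambda> assume le: "\<Theta> \<preceq> \<Lambda>" and da: "\<Lambda> \<tturnstile> d \<^bold>= a"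
        have "\<Lambda> \<tturnstile> d \<^bold>= c" using forces_cong_mem(6)[OF forces_mono[OF le ac]] da by simp
        from forces_mono[OF le b] show "\<Lambda> \<tturnstile> b \<^bold>= d"
        proof (rule forces_OrE)
          fix \<Xi> assume "\<Lambda> \<preceq> \<Xi>" "\<Xi> \<tturnstile> b \<^bold>= c"
          then show "\<Xi> \<tturnstile> b \<^bold>= d" using \<open>\<Lambda> \<tturnstile> d \<^bold>= c\<close> by (metis forces_cong_mem(5) forces_mono forces_sym)
        qed
      qed (rule forces_sym)
      with ac show "\<Theta> \<tturnstile> a \<^bold>= c \<^bold>\<and> b \<^bold>= d" by (simp add: forces_And)
    qed
  qed
  then show "\<Gamma> \<tturnstile> a \<^bold>= c" "\<Gamma> \<tturnstile> b \<^bold>= d" by (simp_all add: forces_And)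
qed

section \<open>Binary unions and unions indexed by a set\<close>

lemma union_memI:
  assumes "collects \<Gamma> U (\<^bold>\<exists>[Suc c] (1 \<^bold>\<in> 0))" "\<Gamma> \<tturnstile> y \<^bold>\<in> c" "\<Gamma> \<tturnstile> z \<^bold>\<in> y"
  shows "\<Gamma> \<tturnstile> z \<^bold>\<in> U"
proof -
  have "\<Gamma> \<tturnstile> \<^bold>\<exists>[c] (Suc z \<^bold>\<in> 0)"
    using assms(2) by (rule forces_BExI) (use assms(3) in \<open>simp add: inst_def\<close>)
  then show ?thesis using assms(1) by (simp add: collects_def inst_def)
qed

lemma union_memE:
  assumes "collects \<Gamma> U (\<^bold>\<exists>[Suc c] (1 \<^bold>\<in> 0))" "\<Gamma> \<tturnstile> z \<^bold>\<in> U"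
    and "\<And>\<Delta> y. \<Gamma> \<preceq> \<Delta> \<Longrightarrow> \<Delta> \<tturnstile> y \<^bold>\<in> c \<Longrightarrow> \<Delta> \<tturnstile> z \<^bold>\<in> y \<Longrightarrow> \<Delta> \<tturnstile> \<psi>"
  shows "\<Gamma> \<tturnstile> \<psi>"
proof -
  have "\<Gamma> \<tturnstile> \<^bold>\<exists>[c] (Suc z \<^bold>\<in> 0)" using assms(1,2) by (simp add: collects_def inst_def)
  then show ?thesis by (rule forces_BExE) (use assms(3) in \<open>auto simp: inst_def\<close>)
qed

text \<open>The union of the two-element set of the given sets.\<close>

lemma is_set_Or:
  assumes "\<Gamma> \<tturnstile> is_set \<phi>" "\<Gamma> \<tturnstile> is_set \<psi>"
  shows "\<Gamma> \<tturnstile> is_set (\<phi> \<^bold>\<or> \<psi>)"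
  using assms(1)
proof (rule is_setE)
  fix \<Delta> a assume "\<Gamma> \<preceq> \<Delta>" and a: "collects \<Delta> a \<phi>"
  from forces_mono[OF this(1) assms(2)] show "\<Delta> \<tturnstile> is_set (\<phi> \<^bold>\<or> \<psi>)"
  proof (rule is_setE)
    fix \<Theta> b assume "\<Delta> \<preceq> \<Theta>" and b: "collects \<Theta> b \<psi>"
    note a = collects_mono[OF this(1) a]
    show "\<Theta> \<tturnstile> is_set (\<phi> \<^bold>\<or> \<psi>)"
    proof (rule is_setE[OF is_set_upair[of _ a b]], unfold collects_upair)
      fix \<Lambda> c assume le: "\<Theta> \<preceq> \<Lambda>" and c: "\<Lambda> \<tturnstile> is_upair c a b"
      note a = collects_mono[OF le a] and b = collects_mono[OF le b]
      show "\<Lambda> \<tturnstile> is_set (\<phi> \<^bold>\<or> \<psi>)"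
      proof (rule is_setE[OF is_set_Union[of _ c]])
        fix \<Xi> U assume le: "\<Lambda> \<preceq> \<Xi>" and U: "collects \<Xi> U (\<^bold>\<exists>[Suc c] (1 \<^bold>\<in> 0))"
        note a = collects_mono[OF le a] and b = collects_mono[OF le b] and c = forces_mono[OF le c]
        have "collects \<Xi> U (\<phi> \<^bold>\<or> \<psi>)"
          unfolding collects_def
        proof (intro HOL.allI HOL.impI iffI)
          fix \<Gamma> z assume "\<Xi> \<preceq> \<Gamma>"
          note U = collects_mono[OF this U] and a = collects_mono[OF this a]
            and b = collects_mono[OF this b] and c = forces_mono[OF this c]
          {
            assume "\<Gamma> \<tturnstile> z \<^bold>\<in> U"
            with U show "\<Gamma> \<tturnstile> inst z (\<phi> \<^bold>\<or> \<psi>)"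
            proof (rule union_memE)
              fix \<Delta> y assume le: "\<Gamma> \<preceq> \<Delta>" and y: "\<Delta> \<tturnstile> y \<^bold>\<in> c" and z: "\<Delta> \<tturnstile> z \<^bold>\<in> y"
              have "\<Delta> \<tturnstile> y \<^bold>= a \<^bold>\<or> y \<^bold>= b"
                using y forces_mono[OF le c] by (simp add: upair_mem)
              then show "\<Delta> \<tturnstile> inst z (\<phi> \<^bold>\<or> \<psi>)"
              proof (rule forces_OrE)
                fix \<Theta> assume "\<Delta> \<preceq> \<Theta>" "\<Theta> \<tturnstile> y \<^bold>= a"
                then have "\<Theta> \<tturnstile> z \<^bold>\<in> a" using z by (metis forces_cong_mem(2) forces_mono)
                then have "\<Theta> \<tturnstile> inst z \<phi>" using a \<open>\<Delta> \<preceq> \<Theta>\<close> le by (meson collects_def extends_trans)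
                then show "\<Theta> \<tturnstile> inst z (\<phi> \<^bold>\<or> \<psi>)" by (simp add: inst_def forces_OrI1)
              next
                fix \<Theta> assume "\<Delta> \<preceq> \<Theta>" "\<Theta> \<tturnstile> y \<^bold>= b"
                then have "\<Theta> \<tturnstile> z \<^bold>\<in> b" using z by (metis forces_cong_mem(2) forces_mono)
                then have "\<Theta> \<tturnstile> inst z \<psi>" using b \<open>\<Delta> \<preceq> \<Theta>\<close> le by (meson collects_def extends_trans)
                then show "\<Theta> \<tturnstile> inst z (\<phi> \<^bold>\<or> \<psi>)" by (simp add: inst_def forces_OrI2)
              qed
            qed
          next
            assume "\<Gamma> \<tturnstile> inst z (\<phi> \<^bold>\<or> \<psi>)"
            then have "\<Gamma> \<tturnstile> inst z \<phi> \<^bold>\<or> inst z \<psi>" by (simp add: inst_def)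
            then have "\<Gamma> \<tturnstile> z \<^bold>\<in> a \<^bold>\<or> z \<^bold>\<in> b"
              by (rule forces_OrE) (meson a b collects_def forces_OrI1 forces_OrI2)+
            moreover have "\<Gamma> \<tturnstile> a \<^bold>\<in> c" "\<Gamma> \<tturnstile> b \<^bold>\<in> c"
              using c by (simp_all add: upair_mem forces_OrI)
            ultimately show "\<Gamma> \<tturnstile> z \<^bold>\<in> U"
              by (elim forces_OrE) (meson U union_memI collects_mono forces_mono)+
          }
        qed
        then show "\<Xi> \<tturnstile> is_set (\<phi> \<^bold>\<or> \<psi>)" by (rule is_setI)
      qed
    qed
  qed
qed

lemma Exists1_ren [simp]: "ren f (\<^bold>\<exists>\<^bold>! \<phi>) = (\<^bold>\<exists>\<^bold>! (ren (lift f) \<phi>))"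
proof -
  have "ren (lift (lift f)) (ren (lift Suc) \<phi>) = ren (lift Suc) (ren (lift f) \<phi>)"
    unfolding ren_ren by (rule ren_eqI) (simp add: lift_def split: nat.split)
  then show ?thesis by (simp add: Exists1_def)
qed

lemma forces_Exists1I:
  assumes "\<Gamma> \<tturnstile> inst y \<phi>" "\<And>\<Delta> y'. \<Gamma> \<preceq> \<Delta> \<Longrightarrow> \<Delta> \<tturnstile> inst y' \<phi> \<Longrightarrow> \<Delta> \<tturnstile> y' \<^bold>= y"
  shows "\<Gamma> \<tturnstile> \<^bold>\<exists>\<^bold>! \<phi>"
proof -
  have "inst y (\<phi> \<^bold>\<and> (\<^bold>\<forall> (ren (lift Suc) \<phi> \<^bold>\<longrightarrow> 0 \<^bold>= 1))) =
    (inst y \<phi> \<^bold>\<and> (\<^bold>\<forall> (ren (lift (subst0 y)) (ren (lift Suc) \<phi>) \<^bold>\<longrightarrow> 0 \<^bold>= Suc y)))"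
    by (simp add: inst_def)
  moreover have "inst y' (ren (lift (subst0 y)) (ren (lift Suc) \<phi>) \<^bold>\<longrightarrow> 0 \<^bold>= Suc y) =
    (inst y' \<phi> \<^bold>\<longrightarrow> y' \<^bold>= y)" for y'
    by (subst inst_subst0_weaken1[of y' y, symmetric]) (simp add: inst_def)
  ultimately have "\<Gamma> \<tturnstile> inst y (\<phi> \<^bold>\<and> (\<^bold>\<forall> (ren (lift Suc) \<phi> \<^bold>\<longrightarrow> 0 \<^bold>= 1)))"
    using assms by (simp add: forces_And forces_Forall forces_Imp)
  then show ?thesis unfolding Exists1_def by (rule forces_ExistsI)
qed

text \<open>Extensionality makes a set uniquely determined by its defining class, which is the form of
  functionality that Replacement asks for.\<close>

lemma is_set_Exists1:
  assumes "\<Gamma> \<tturnstile> is_set \<phi>"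
  shows "\<Gamma> \<tturnstile> \<^bold>\<exists>\<^bold>! (\<^bold>\<forall> (0 \<^bold>\<in> 1 \<^bold>\<longleftrightarrow> ren (lift Suc) \<phi>))"
  using assms
proof (rule is_setE)
  fix \<Delta> b assume "collects \<Delta> b \<phi>"
  then show "\<Delta> \<tturnstile> \<^bold>\<exists>\<^bold>! (\<^bold>\<forall> (0 \<^bold>\<in> 1 \<^bold>\<longleftrightarrow> ren (lift Suc) \<phi>))"
    by (intro forces_Exists1I[of _ b]) (metis collects_iff collects_mono collects_unique)+
qed

text \<open>\<open>{y | \<exists>x\<in>a. y = {z | \<theta>(z, x)}}\<close> is a set, by Replacement for the formula \<open>y = {z | \<theta>(z, x)}\<close>. In \<open>\<theta>\<close>,
  variable 0 is \<open>x\<close> and variable 1 is \<open>z\<close>; the two \<open>case_nat\<close> renamings move them below the binders of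
  Replacement and of the resulting class. Functionality holds because \<open>y\<close> is given by its elements.\<close>

lemma is_set_replacement:
  assumes "\<And>\<Delta> x. \<Gamma> \<preceq> \<Delta> \<Longrightarrow> \<Delta> \<tturnstile> x \<^bold>\<in> a \<Longrightarrow> \<Delta> \<tturnstile> is_set (inst (Suc x) \<theta>)"
  shows "\<Gamma> \<tturnstile> is_set (\<^bold>\<exists>[Suc a] (\<^bold>\<forall> (0 \<^bold>\<in> 2 \<^bold>\<longleftrightarrow> ren (case_nat 1 (case_nat 0 (\<lambda>m. m + 3))) \<theta>)))"
proof -
  define \<phi> where "\<phi> = (\<^bold>\<forall> (0 \<^bold>\<in> 1 \<^bold>\<longleftrightarrow> ren (case_nat 2 (case_nat 0 (\<lambda>m. m + 4))) \<theta>))"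
  \<comment> \<open>\<open>y = {z | \<theta>(z, x)}\<close>; in its body the variables are \<open>z, y, x, a\<close> and then the parameters.\<close>
  have "univ_closure (ax_replacement \<phi>) \<in> ECST" unfolding ECST_def by blast
  then have "\<Gamma> \<tturnstile> ax_replacement \<phi>" by (rule ECST_forces_closure)
  then have "\<Gamma> \<tturnstile> inst a ((\<^bold>\<forall>[0] (\<^bold>\<exists>\<^bold>! \<phi>)) \<^bold>\<longrightarrow>
       (\<^bold>\<exists> (\<^bold>\<forall> (0 \<^bold>\<in> 1 \<^bold>\<longleftrightarrow>
         (\<^bold>\<exists>[2] (ren (\<lambda>n. if n = 0 then 1 else if n = 1 then 0 else n + 1) \<phi>))))))"
    unfolding ax_replacement_def forces_Forall by blast
  also have "inst a ((\<^bold>\<forall>[0] (\<^bold>\<exists>\<^bold>! \<phi>)) \<^bold>\<longrightarrow>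
       (\<^bold>\<exists> (\<^bold>\<forall> (0 \<^bold>\<in> 1 \<^bold>\<longleftrightarrow>
         (\<^bold>\<exists>[2] (ren (\<lambda>n. if n = 0 then 1 else if n = 1 then 0 else n + 1) \<phi>)))))) =
    ((\<^bold>\<forall>[a] (\<^bold>\<exists>\<^bold>! (ren (lift (lift (subst0 a))) \<phi>))) \<^bold>\<longrightarrow>
       is_set (\<^bold>\<exists>[Suc a] (\<^bold>\<forall> (0 \<^bold>\<in> 2 \<^bold>\<longleftrightarrow> ren (case_nat 1 (case_nat 0 (\<lambda>m. m + 3))) \<theta>))))"
    unfolding is_set_def \<phi>_def
    by (simp add: inst_def ren_ren numeral_eq_Suc)
      (rule arg_cong[of _ _ "\<lambda>\<xi>. 0 \<^bold>\<in> Suc 0 \<^bold>\<longleftrightarrow> (\<^bold>\<exists>[Suc (Suc a)] (\<^bold>\<forall> (0 \<^bold>\<in> Suc (Suc 0) \<^bold>\<longleftrightarrow> \<xi>)))"],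
        rule ren_eqI, simp add: lift_def split: nat.split)
  finally have *: "\<Gamma> \<tturnstile> \<dots>" .
  moreover have "\<Gamma> \<tturnstile> \<^bold>\<forall>[a] (\<^bold>\<exists>\<^bold>! (ren (lift (lift (subst0 a))) \<phi>))"
    unfolding forces_BAll
  proof (intro HOL.allI HOL.impI)
    fix \<Delta> x assume "\<Gamma> \<preceq> \<Delta>" "\<Delta> \<tturnstile> x \<^bold>\<in> a"
    then have "\<Delta> \<tturnstile> \<^bold>\<exists>\<^bold>! (\<^bold>\<forall> (0 \<^bold>\<in> 1 \<^bold>\<longleftrightarrow> ren (lift Suc) (inst (Suc x) \<theta>)))"
      by (intro is_set_Exists1 assms)
    also have "(\<^bold>\<exists>\<^bold>! (\<^bold>\<forall> (0 \<^bold>\<in> 1 \<^bold>\<longleftrightarrow> ren (lift Suc) (inst (Suc x) \<theta>)))) =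
      inst x (\<^bold>\<exists>\<^bold>! (ren (lift (lift (subst0 a))) \<phi>))"
      unfolding \<phi>_def
      by (simp add: inst_def ren_ren numeral_eq_Suc)
        (rule arg_cong[of _ _ "\<lambda>\<xi>. \<^bold>\<exists>\<^bold>! (\<^bold>\<forall> (0 \<^bold>\<in> Suc 0 \<^bold>\<longleftrightarrow> \<xi>))"],
          rule ren_eqI, simp add: lift_def split: nat.split)
    finally show "\<Delta> \<tturnstile> inst x (\<^bold>\<exists>\<^bold>! (ren (lift (lift (subst0 a))) \<phi>))" .
  qed
  ultimately show ?thesis by (simp add: forces_Imp)
qed

lemma inst_BEx: "inst z (\<^bold>\<exists>[Suc a] \<theta>) = (\<^bold>\<exists>[a] (ren (lift (subst0 z)) \<theta>))"
  by (simp add: inst_def)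

text \<open>The class \<open>{z | \<exists>x\<in>a. \<theta>(z, x)}\<close> is the union of the sets \<open>{z | \<theta>(z, x)}\<close> for \<open>x \<in> a\<close>, which form
  a set by \<open>is_set_replacement\<close>. All uses of Replacement below go through this lemma.\<close>

lemma is_set_BEx:
  assumes "\<And>\<Delta> x. \<Gamma> \<preceq> \<Delta> \<Longrightarrow> \<Delta> \<tturnstile> x \<^bold>\<in> a \<Longrightarrow> \<Delta> \<tturnstile> is_set (inst (Suc x) \<theta>)"
  shows "\<Gamma> \<tturnstile> is_set (\<^bold>\<exists>[Suc a] \<theta>)"
proof -
  define \<omega> where "\<omega> = (\<^bold>\<forall> (0 \<^bold>\<in> 2 \<^bold>\<longleftrightarrow> ren (case_nat 1 (case_nat 0 (\<lambda>m. m + 3))) \<theta>))"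
  have "inst x (ren (lift (subst0 y)) \<omega>) = inst y (\<^bold>\<forall> (0 \<^bold>\<in> 1 \<^bold>\<longleftrightarrow> ren (lift Suc) (inst (Suc x) \<theta>)))" for x y
    unfolding \<omega>_def
    by (simp add: inst_def ren_ren numeral_eq_Suc)
      (rule arg_cong[of _ _ "\<lambda>\<xi>. 0 \<^bold>\<in> Suc y \<^bold>\<longleftrightarrow> \<xi>"], rule ren_eqI, simp add: lift_def split: nat.split)
  then have \<omega>: "(\<Delta> \<tturnstile> inst x (ren (lift (subst0 y)) \<omega>)) = collects \<Delta> y (inst (Suc x) \<theta>)" for \<Delta> x y
    by (simp add: collects_iff)
  have "\<Gamma> \<tturnstile> is_set (\<^bold>\<exists>[Suc a] \<omega>)"
    unfolding \<omega>_def by (rule is_set_replacement) (rule assms)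
  then show ?thesis
  proof (rule is_setE)
    fix \<Delta> b assume le1: "\<Gamma> \<preceq> \<Delta>" and b: "collects \<Delta> b (\<^bold>\<exists>[Suc a] \<omega>)"
    show "\<Delta> \<tturnstile> is_set (\<^bold>\<exists>[Suc a] \<theta>)"
    proof (rule is_setE[OF is_set_Union[of _ b]])
      fix \<Theta> U assume le2: "\<Delta> \<preceq> \<Theta>" and U: "collects \<Theta> U (\<^bold>\<exists>[Suc b] (1 \<^bold>\<in> 0))"
      have "collects \<Theta> U (\<^bold>\<exists>[Suc a] \<theta>)"
        unfolding collects_def inst_BEx
      proof (intro HOL.allI HOL.impI iffI)
        fix \<Lambda> z assume le3: "\<Theta> \<preceq> \<Lambda>"
        note U = collects_mono[OF le3 U] and b = collects_mono[OF le3 collects_mono[OF le2 b]]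
        {
          assume "\<Lambda> \<tturnstile> z \<^bold>\<in> U"
          with U show "\<Lambda> \<tturnstile> \<^bold>\<exists>[a] (ren (lift (subst0 z)) \<theta>)"
          proof (rule union_memE)
            fix \<Xi> y assume "\<Lambda> \<preceq> \<Xi>" "\<Xi> \<tturnstile> y \<^bold>\<in> b" and z: "\<Xi> \<tturnstile> z \<^bold>\<in> y"
            with b have "\<Xi> \<tturnstile> \<^bold>\<exists>[a] (ren (lift (subst0 y)) \<omega>)"
              by (simp add: collects_def inst_BEx)
            then show "\<Xi> \<tturnstile> \<^bold>\<exists>[a] (ren (lift (subst0 z)) \<theta>)"
              by (rule forces_BExE, unfold \<omega>)
                (rule forces_BExI, assumption, use z in \<open>auto simp: collects_def inst_swap intro: forces_mono\<close>)
          qed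
        next
          assume "\<Lambda> \<tturnstile> \<^bold>\<exists>[a] (ren (lift (subst0 z)) \<theta>)"
          then show "\<Lambda> \<tturnstile> z \<^bold>\<in> U"
          proof (rule forces_BExE, unfold inst_swap)
            fix \<Xi> x assume le4: "\<Lambda> \<preceq> \<Xi>" and x: "\<Xi> \<tturnstile> x \<^bold>\<in> a" and z: "\<Xi> \<tturnstile> inst z (inst (Suc x) \<theta>)"
            have "\<Xi> \<tturnstile> is_set (inst (Suc x) \<theta>)"
              using x by (rule assms[rotated]) (meson le1 le2 le3 le4 extends_trans)
            then show "\<Xi> \<tturnstile> z \<^bold>\<in> U"
            proof (rule is_setE)
              fix \<Psi> y assume le5: "\<Xi> \<preceq> \<Psi>" and y: "collects \<Psi> y (inst (Suc x) \<theta>)"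
              have "\<Psi> \<tturnstile> \<^bold>\<exists>[a] (ren (lift (subst0 y)) \<omega>)"
                by (rule forces_BExI[OF forces_mono[OF le5 x]]) (simp add: \<omega> y)
              then have "\<Psi> \<tturnstile> y \<^bold>\<in> b"
                using collects_mono[OF le5 collects_mono[OF le4 b]] by (simp add: collects_def inst_BEx)
              moreover have "\<Psi> \<tturnstile> z \<^bold>\<in> y"
                using y forces_mono[OF le5 z] by (simp add: collects_def)
              ultimately show "\<Psi> \<tturnstile> z \<^bold>\<in> U"
                by (rule union_memI[OF collects_mono[OF le5 collects_mono[OF le4 U]]])
            qed
          qed
        }
      qed
      then show "\<Theta> \<tturnstile> is_set (\<^bold>\<exists>[Suc a] \<theta>)" by (rule is_setI)
    qed
  qed
qed

lemma forces_cong_ren: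
  assumes "\<Gamma> \<tturnstile> a \<^bold>= a'" "\<Gamma> \<tturnstile> b \<^bold>= b'"
  shows "(\<Gamma> \<tturnstile> ren (case_nat b (case_nat a f)) \<phi>) = (\<Gamma> \<tturnstile> ren (case_nat b' (case_nat a' f)) \<phi>)"
proof -
  have 0: "ren (case_nat t g) \<phi> = inst t (ren (lift g) \<phi>)" for t g
    unfolding inst_def ren_ren by (rule ren_eqI) (simp add: lift_def split: nat.split)
  have 1: "ren (case_nat b (case_nat t f)) \<phi> =
    inst t (ren (case_nat (Suc b) (case_nat 0 (\<lambda>m. Suc (f m)))) \<phi>)" for t
    unfolding inst_def ren_ren by (rule ren_eqI) (simp split: nat.split)
  show ?thesis
    using forces_cong[OF assms(1), of "ren (case_nat (Suc b) (case_nat 0 (\<lambda>m. Suc (f m)))) \<phi>"]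
      forces_cong[OF assms(2), of "ren (lift (case_nat a' f)) \<phi>"]
    unfolding 0[symmetric] 1[symmetric] by simp
qed

lemma pair_unique:
  assumes "\<Gamma> \<tturnstile> is_pair p x y" "\<Gamma> \<tturnstile> is_pair q x y"
  shows "\<Gamma> \<tturnstile> p \<^bold>= q"
  using assms(1)
proof (rule pairE)
  fix \<Delta> u v
  assume le: "\<Gamma> \<preceq> \<Delta>" and "\<Delta> \<tturnstile> is_sing u x" "\<Delta> \<tturnstile> is_upair v x y" "\<Delta> \<tturnstile> is_upair p u v"
  note 1 = this(2-)
  show "\<Delta> \<tturnstile> p \<^bold>= q"
    using forces_mono[OF le assms(2)]
  proof (rule pairE)
    fix \<Theta> u' v'
    assume le: "\<Delta> \<preceq> \<Theta>" and 2: "\<Theta> \<tturnstile> is_sing u' x" "\<Theta> \<tturnstile> is_upair v' x y" "\<Theta> \<tturnstile> is_upair q u' v'"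
    note 1 = 1[THEN forces_mono[OF le]]
    have u: "\<Theta> \<tturnstile> u' \<^bold>= u" and v: "\<Theta> \<tturnstile> v' \<^bold>= v"
      using 1 2 by (auto simp: collects_sing[symmetric] collects_upair[symmetric] intro: collects_unique)
    have "\<Theta> \<tturnstile> is_upair q u v"
      using 2(3) forces_cong[OF u, of "is_upair (Suc q) 0 (Suc v')"]
        forces_cong[OF v, of "is_upair (Suc q) (Suc u) 0"]
      by (simp add: inst_def)
    then show "\<Theta> \<tturnstile> p \<^bold>= q"
      using 1(3) by (auto simp: collects_upair[symmetric] intro: collects_unique)
  qed
qed

section \<open>Classes of pairs and classes indexed by rules\<close>

text \<open>\<open>z = ({w | \<phi>(w)}, b)\<close>; variable 0 of \<open>\<phi>\<close> is \<open>w\<close>.\<close>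

definition pair_of :: "nat \<Rightarrow> fm \<Rightarrow> nat \<Rightarrow> fm"
  where "pair_of z \<phi> b = (\<^bold>\<exists> ((\<^bold>\<forall> (0 \<^bold>\<in> 1 \<^bold>\<longleftrightarrow> ren (lift Suc) \<phi>)) \<^bold>\<and> is_pair (Suc z) 0 (Suc b)))"

lemma pair_of_ren [simp]: "ren f (pair_of z \<phi> b) = pair_of (f z) (ren (lift f) \<phi>) (f b)"
proof -
  have "ren (lift (lift f)) (ren (lift Suc) \<phi>) = ren (lift Suc) (ren (lift f) \<phi>)"
    unfolding ren_ren by (rule ren_eqI) (simp add: lift_def split: nat.split)
  then show ?thesis by (simp add: pair_of_def)
qed

lemma inst_pair_of: "inst u ((\<^bold>\<forall> (0 \<^bold>\<in> 1 \<^bold>\<longleftrightarrow> ren (lift Suc) \<phi>)) \<^bold>\<and> is_pair (Suc z) 0 (Suc b)) =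
    (inst u (\<^bold>\<forall> (0 \<^bold>\<in> 1 \<^bold>\<longleftrightarrow> ren (lift Suc) \<phi>)) \<^bold>\<and> is_pair z u b)"
  by (simp add: inst_def)

lemma pair_ofI: "collects \<Gamma> u \<phi> \<Longrightarrow> \<Gamma> \<tturnstile> is_pair z u b \<Longrightarrow> \<Gamma> \<tturnstile> pair_of z \<phi> b"
  unfolding pair_of_def
  by (rule forces_ExistsI[of _ u], unfold inst_pair_of) (simp add: collects_iff forces_And)

lemma pair_ofE:
  assumes "\<Gamma> \<tturnstile> pair_of z \<phi> b"
    and "\<And>\<Delta> u. \<Gamma> \<preceq> \<Delta> \<Longrightarrow> collects \<Delta> u \<phi> \<Longrightarrow> \<Delta> \<tturnstile> is_pair z u b \<Longrightarrow> \<Delta> \<tturnstile> \<psi>"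
  shows "\<Gamma> \<tturnstile> \<psi>"
  using assms(1) unfolding pair_of_def
  by (rule forces_ExistsE, unfold inst_pair_of) (use assms(2) in \<open>auto simp: collects_iff forces_And\<close>)

text \<open>\<open>{({w | \<phi>(w)}, b)}\<close> is a singleton: its element exists by pairing and is unique by
  extensionality.\<close>

lemma is_set_pair_of:
  assumes "\<Gamma> \<tturnstile> is_set \<phi>"
  shows "\<Gamma> \<tturnstile> is_set (pair_of 0 (ren (lift Suc) \<phi>) (Suc b))"
  using assms
proof (rule is_setE)
  fix \<Delta> u assume u: "collects \<Delta> u \<phi>"
  show "\<Delta> \<tturnstile> is_set (pair_of 0 (ren (lift Suc) \<phi>) (Suc b))"
  proof (rule pair_exists[of _ u b])
    fix \<Theta> p assume le: "\<Delta> \<preceq> \<Theta>" and p: "\<Theta> \<tturnstile> is_pair p u b"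
    note u = collects_mono[OF le u]
    show "\<Theta> \<tturnstile> is_set (pair_of 0 (ren (lift Suc) \<phi>) (Suc b))"
    proof (rule is_set_cong[OF is_set_sing[of _ p]])
      fix \<Lambda> z assume le: "\<Theta> \<preceq> \<Lambda>"
      note u = collects_mono[OF le u] and p = forces_mono[OF le p]
      have "(\<Lambda> \<tturnstile> z \<^bold>= p) = (\<Lambda> \<tturnstile> pair_of z \<phi> b)"
      proof
        assume "\<Lambda> \<tturnstile> z \<^bold>= p"
        then have "\<Lambda> \<tturnstile> is_pair z u b" using p forces_cong_pair(1) by blast
        with u show "\<Lambda> \<tturnstile> pair_of z \<phi> b" by (rule pair_ofI)
      next
        assume "\<Lambda> \<tturnstile> pair_of z \<phi> b"
        then show "\<Lambda> \<tturnstile> z \<^bold>= p"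
        proof (rule pair_ofE)
          fix \<Xi> u' assume le: "\<Lambda> \<preceq> \<Xi>" and u': "collects \<Xi> u' \<phi>" and z: "\<Xi> \<tturnstile> is_pair z u' b"
          have "\<Xi> \<tturnstile> u' \<^bold>= u" using u' collects_mono[OF le u] by (rule collects_unique)
          then have "\<Xi> \<tturnstile> is_pair z u b" using z forces_cong_pair(2) by blast
          then show "\<Xi> \<tturnstile> z \<^bold>= p" using forces_mono[OF le p] by (rule pair_unique)
        qed
      qed
      then show "(\<Lambda> \<tturnstile> inst z (0 \<^bold>= Suc p)) = (\<Lambda> \<tturnstile> inst z (pair_of 0 (ren (lift Suc) \<phi>) (Suc b)))"
        by (simp add: inst_def ren_subst0_weaken1)
    qed
  qed
qed

text \<open>\<open>r\<close> is a pair \<open>(a, b)\<close> with \<open>\<xi>(a, b)\<close>, where \<open>b\<close> is variable 0 and \<open>a\<close> is variable 1 of \<open>\<xi>\<close>. Rules and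
  elementary rules are instances.\<close>

definition ex_pair :: "nat \<Rightarrow> fm \<Rightarrow> fm"
  where "ex_pair r \<xi> = (\<^bold>\<exists> (\<^bold>\<exists> (is_pair (Suc (Suc r)) 1 0 \<^bold>\<and> \<xi>)))"

lemma ex_pair_ren [simp]: "ren f (ex_pair r \<xi>) = ex_pair (f r) (ren (lift (lift f)) \<xi>)"
  by (simp add: ex_pair_def)

lemma inst_ex_pair:
  "inst a (\<^bold>\<exists> (is_pair (Suc (Suc r)) 1 0 \<^bold>\<and> \<xi>)) = (\<^bold>\<exists> (is_pair (Suc r) (Suc a) 0 \<^bold>\<and> ren (lift (subst0 a)) \<xi>))"
  "inst b (is_pair (Suc r) (Suc a) 0 \<^bold>\<and> ren (lift (subst0 a)) \<xi>) =
    (is_pair r a b \<^bold>\<and> ren (case_nat b (subst0 a)) \<xi>)"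
proof -
  have "ren (subst0 b) (ren (lift (subst0 a)) \<xi>) = ren (case_nat b (subst0 a)) \<xi>"
    unfolding ren_ren by (rule ren_eqI) (simp add: lift_def split: nat.split)
  then show "inst b (is_pair (Suc r) (Suc a) 0 \<^bold>\<and> ren (lift (subst0 a)) \<xi>) =
    (is_pair r a b \<^bold>\<and> ren (case_nat b (subst0 a)) \<xi>)"
    by (simp add: inst_def)
qed (simp add: inst_def)

lemma ex_pairI:
  assumes "\<Gamma> \<tturnstile> is_pair r a b" "\<Gamma> \<tturnstile> ren (case_nat b (subst0 a)) \<xi>"
  shows "\<Gamma> \<tturnstile> ex_pair r \<xi>"
  unfolding ex_pair_def
  by (rule forces_ExistsI[of _ a], unfold inst_ex_pair, rule forces_ExistsI[of _ b], unfold inst_ex_pair)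
    (simp add: forces_And assms)

lemma ex_pairE:
  assumes "\<Gamma> \<tturnstile> ex_pair r \<xi>"
    and *: "\<And>\<Delta> a b. \<Gamma> \<preceq> \<Delta> \<Longrightarrow> \<Delta> \<tturnstile> is_pair r a b \<Longrightarrow>
      \<Delta> \<tturnstile> ren (case_nat b (subst0 a)) \<xi> \<Longrightarrow> \<Delta> \<tturnstile> \<psi>"
  shows "\<Gamma> \<tturnstile> \<psi>"
  using assms(1) unfolding ex_pair_def
proof (rule forces_ExistsE, unfold inst_ex_pair)
  fix \<Delta> a assume le: "\<Gamma> \<preceq> \<Delta>"
    and "\<Delta> \<tturnstile> \<^bold>\<exists> (is_pair (Suc r) (Suc a) 0 \<^bold>\<and> ren (lift (subst0 a)) \<xi>)"
  from this(2) show "\<Delta> \<tturnstile> \<psi>"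
    by (rule forces_ExistsE, unfold inst_ex_pair forces_And) (use le in \<open>blast intro: * extends_trans\<close>)
qed

text \<open>The class \<open>{z | \<exists>(a, b)\<in>R. \<xi>(z, a, b)}\<close>, where variables 0, 1 and 2 of \<open>\<xi>\<close> are \<open>b\<close>, \<open>a\<close> and \<open>z\<close>. Both sets
  of rules constructed below have this form.\<close>

definition over_pairs :: "nat \<Rightarrow> fm \<Rightarrow> fm"
  where "over_pairs R \<xi> = (\<^bold>\<exists>[Suc R] (ex_pair 0 (ren (lift (lift Suc)) \<xi>)))"

text \<open>\<open>\<xi>(z, a, b)\<close> for variables \<open>z\<close>, \<open>a\<close>, \<open>b\<close>, in the convention of \<^const>\<open>over_pairs\<close>.\<close>

definition inst3 :: "nat \<Rightarrow> nat \<Rightarrow> nat \<Rightarrow> fm \<Rightarrow> fm"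
  where "inst3 z a b \<xi> = ren (case_nat b (case_nat a (subst0 z))) \<xi>"

lemma inst_Suc_ex_pair: "inst (Suc r) (ex_pair 0 (ren (lift (lift Suc)) \<xi>)) = ex_pair (Suc r) \<xi>"
proof -
  have "ren (lift (lift (subst0 (Suc r)))) (ren (lift (lift Suc)) \<xi>) = ren (\<lambda>n. n) \<xi>"
    unfolding ren_ren by (rule ren_eqI) (simp add: lift_def split: nat.split)
  then show ?thesis by (simp add: inst_def ren_id)
qed

lemma inst_ex_pair_Suc: "inst z (ex_pair (Suc r) \<xi>) = ex_pair r (ren (lift (lift (subst0 z))) \<xi>)"
  by (simp add: inst_def)

lemma inst3_eq:
  "ren (case_nat b (subst0 a)) (ren (lift (lift (subst0 z))) \<xi>) = inst3 z a b \<xi>"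
  "inst z (ren (case_nat (Suc b) (case_nat (Suc a) (\<lambda>m. m))) \<xi>) = inst3 z a b \<xi>"
  unfolding inst_def inst3_def ren_ren by (rule ren_eqI, simp add: lift_def split: nat.split)+

lemma over_pairsI:
  assumes "\<Gamma> \<tturnstile> r \<^bold>\<in> R" "\<Gamma> \<tturnstile> is_pair r a b" "\<Gamma> \<tturnstile> inst3 z a b \<xi>"
  shows "\<Gamma> \<tturnstile> inst z (over_pairs R \<xi>)"
  unfolding over_pairs_def inst_BEx
  by (rule forces_BExI[OF assms(1)], unfold inst_swap inst_Suc_ex_pair inst_ex_pair_Suc)
    (rule ex_pairI[OF assms(2)], simp add: inst3_eq assms(3))

lemma over_pairsE:
  assumes "\<Gamma> \<tturnstile> inst z (over_pairs R \<xi>)"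
    and *: "\<And>\<Delta> r a b. \<Gamma> \<preceq> \<Delta> \<Longrightarrow> \<Delta> \<tturnstile> r \<^bold>\<in> R \<Longrightarrow> \<Delta> \<tturnstile> is_pair r a b \<Longrightarrow> \<Delta> \<tturnstile> inst3 z a b \<xi> \<Longrightarrow> \<Delta> \<tturnstile> \<psi>"
  shows "\<Gamma> \<tturnstile> \<psi>"
  using assms(1) unfolding over_pairs_def inst_BEx
proof (rule forces_BExE, unfold inst_swap inst_Suc_ex_pair inst_ex_pair_Suc)
  fix \<Delta> r assume le: "\<Gamma> \<preceq> \<Delta>" and r: "\<Delta> \<tturnstile> r \<^bold>\<in> R"
    and "\<Delta> \<tturnstile> ex_pair r (ren (lift (lift (subst0 z))) \<xi>)"
  from this(3) show "\<Delta> \<tturnstile> \<psi>"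
    by (rule ex_pairE, unfold inst3_eq) (meson * le r extends_trans forces_mono)
qed

lemma is_ruleI: "\<Gamma> \<tturnstile> is_pair r a b \<Longrightarrow> \<Gamma> \<tturnstile> a \<^bold>\<subseteq> S \<Longrightarrow> \<Gamma> \<tturnstile> b \<^bold>\<subseteq> S \<Longrightarrow> \<Gamma> \<tturnstile> is_rule r S"
  using ex_pairI[of \<Gamma> r a b "1 \<^bold>\<subseteq> (S + 2) \<^bold>\<and> 0 \<^bold>\<subseteq> (S + 2)"]
  by (simp add: is_rule_def ex_pair_def forces_And)

lemma is_ruleE:
  assumes "\<Gamma> \<tturnstile> is_rule r S"
    "\<And>\<Delta> a b. \<Gamma> \<preceq> \<Delta> \<Longrightarrow> \<Delta> \<tturnstile> is_pair r a b \<Longrightarrow> \<Delta> \<tturnstile> a \<^bold>\<subseteq> S \<Longrightarrow> \<Delta> \<tturnstile> b \<^bold>\<subseteq> S \<Longrightarrow> \<Delta> \<tturnstile> \<psi>"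
  shows "\<Gamma> \<tturnstile> \<psi>"
  by (rule ex_pairE[of \<Gamma> r "1 \<^bold>\<subseteq> (S + 2) \<^bold>\<and> 0 \<^bold>\<subseteq> (S + 2)"])
    (use assms in \<open>auto simp: is_rule_def ex_pair_def forces_And\<close>)

lemma is_elementary_ruleI:
  assumes "\<Gamma> \<tturnstile> is_pair r a b" "\<Gamma> \<tturnstile> a \<^bold>\<subseteq> S" "\<Gamma> \<tturnstile> b \<^bold>\<subseteq> S" "\<Gamma> \<tturnstile> is_sing a x"
  shows "\<Gamma> \<tturnstile> is_elementary_rule r S"
proof -
  have "\<Gamma> \<tturnstile> \<^bold>\<exists> (is_sing (Suc a) 0)"
    by (rule forces_ExistsI[of _ x]) (simp add: inst_def assms(4))
  then show ?thesis
    using assms(1-3) ex_pairI[of \<Gamma> r a b "1 \<^bold>\<subseteq> (S + 2) \<^bold>\<and> 0 \<^bold>\<subseteq> (S + 2) \<^bold>\<and> (\<^bold>\<exists> (is_sing 2 0))"]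
    by (simp add: is_elementary_rule_def ex_pair_def forces_And numeral_eq_Suc)
qed

lemma is_elementary_ruleE:
  assumes "\<Gamma> \<tturnstile> is_elementary_rule r S"
    and *: "\<And>\<Delta> a b x. \<Gamma> \<preceq> \<Delta> \<Longrightarrow> \<Delta> \<tturnstile> is_pair r a b \<Longrightarrow> \<Delta> \<tturnstile> a \<^bold>\<subseteq> S \<Longrightarrow> \<Delta> \<tturnstile> b \<^bold>\<subseteq> S \<Longrightarrow>
      \<Delta> \<tturnstile> is_sing a x \<Longrightarrow> \<Delta> \<tturnstile> \<psi>"
  shows "\<Gamma> \<tturnstile> \<psi>"
proof (rule ex_pairE[of \<Gamma> r "1 \<^bold>\<subseteq> (S + 2) \<^bold>\<and> 0 \<^bold>\<subseteq> (S + 2) \<^bold>\<and> (\<^bold>\<exists> (is_sing 2 0))"])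
  show "\<Gamma> \<tturnstile> ex_pair r (1 \<^bold>\<subseteq> (S + 2) \<^bold>\<and> 0 \<^bold>\<subseteq> (S + 2) \<^bold>\<and> (\<^bold>\<exists> (is_sing 2 0)))"
    using assms(1) by (simp add: is_elementary_rule_def ex_pair_def)
next
  fix \<Delta> a b assume le: "\<Gamma> \<preceq> \<Delta>" and ab: "\<Delta> \<tturnstile> is_pair r a b"
    and "\<Delta> \<tturnstile> ren (case_nat b (subst0 a)) (1 \<^bold>\<subseteq> (S + 2) \<^bold>\<and> 0 \<^bold>\<subseteq> (S + 2) \<^bold>\<and> (\<^bold>\<exists> (is_sing 2 0)))"
  then have sub: "\<Delta> \<tturnstile> a \<^bold>\<subseteq> S" "\<Delta> \<tturnstile> b \<^bold>\<subseteq> S" and "\<Delta> \<tturnstile> \<^bold>\<exists> (is_sing (Suc a) 0)"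
    by (simp_all add: forces_And numeral_eq_Suc)
  from this(3) show "\<Delta> \<tturnstile> \<psi>"
    by (rule forces_ExistsE) (use le ab sub in \<open>auto simp: inst_def intro: * extends_trans forces_mono\<close>)
qed

lemma rule_subsets:
  assumes "\<Gamma> \<tturnstile> is_rule r S" "\<Gamma> \<tturnstile> is_pair r a b"
  shows "\<Gamma> \<tturnstile> a \<^bold>\<subseteq> S" "\<Gamma> \<tturnstile> b \<^bold>\<subseteq> S"
  using assms(1) by (rule is_ruleE, use assms(2) in \<open>metis forces_mono pair_inj forces_cong_mem(4)\<close>)+

lemma elementary_rule_is_rule: "\<Gamma> \<tturnstile> is_elementary_rule r S \<Longrightarrow> \<Gamma> \<tturnstile> is_rule r S"
  by (erule is_elementary_ruleE) (rule is_ruleI)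

lemma elementary_rule_sing:
  assumes "\<Gamma> \<tturnstile> is_elementary_rule r S" "\<Gamma> \<tturnstile> is_pair r a b"
    and "\<And>\<Delta> x. \<Gamma> \<preceq> \<Delta> \<Longrightarrow> \<Delta> \<tturnstile> is_sing a x \<Longrightarrow> \<Delta> \<tturnstile> \<psi>"
  shows "\<Gamma> \<tturnstile> \<psi>"
  using assms(1)
proof (rule is_elementary_ruleE)
  fix \<Delta> a' b' x assume le: "\<Gamma> \<preceq> \<Delta>" and "\<Delta> \<tturnstile> is_pair r a' b'" "\<Delta> \<tturnstile> is_sing a' x"
  then have "\<Delta> \<tturnstile> a' \<^bold>= a" using assms(2) forces_mono pair_inj(1) by blast
  then have "\<Delta> \<tturnstile> is_sing a x"
    using \<open>\<Delta> \<tturnstile> is_sing a' x\<close> forces_cong[of \<Delta> a' a "is_sing 0 (Suc x)"] by (simp add: inst_def)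
  with le show "\<Delta> \<tturnstile> \<psi>" by (rule assms(3))
qed

text \<open>For a rule \<open>r = (a, b)\<close> the section \<open>{z | \<exists>a' b'. r = (a', b') \<and> \<xi>(z, a', b')}\<close> equals
  \<open>{z | \<xi>(z, a, b)}\<close> by injectivity of pairing, so it is a set, and the union over \<open>R\<close> is a set.\<close>

lemma is_set_over_pairs:
  assumes rules: "\<Gamma> \<tturnstile> \<^bold>\<forall>[R] (is_rule 0 (Suc S))"
    and sets: "\<And>\<Delta> a b. \<Gamma> \<preceq> \<Delta> \<Longrightarrow> \<Delta> \<tturnstile> is_set (ren (case_nat (Suc b) (case_nat (Suc a) (\<lambda>m. m))) \<xi>)"
  shows "\<Gamma> \<tturnstile> is_set (over_pairs R \<xi>)"
  unfolding over_pairs_def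
proof (rule is_set_BEx, unfold inst_Suc_ex_pair)
  fix \<Delta> r assume le: "\<Gamma> \<preceq> \<Delta>" and r: "\<Delta> \<tturnstile> r \<^bold>\<in> R"
  then have "\<Delta> \<tturnstile> is_rule r S" using rules by (auto simp: forces_BAll inst_def)
  then show "\<Delta> \<tturnstile> is_set (ex_pair (Suc r) \<xi>)"
  proof (rule is_ruleE)
    fix \<Theta> a b assume le': "\<Delta> \<preceq> \<Theta>" and ab: "\<Theta> \<tturnstile> is_pair r a b"
    have "\<Theta> \<tturnstile> is_set (ren (case_nat (Suc b) (case_nat (Suc a) (\<lambda>m. m))) \<xi>)"
      by (rule sets) (rule extends_trans[OF le le'])
    then show "\<Theta> \<tturnstile> is_set (ex_pair (Suc r) \<xi>)"
    proof (rule is_set_cong, unfold inst_ex_pair_Suc inst3_eq)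
      fix \<Lambda> z assume "\<Theta> \<preceq> \<Lambda>"
      note ab = forces_mono[OF this ab]
      show "(\<Lambda> \<tturnstile> inst3 z a b \<xi>) = (\<Lambda> \<tturnstile> ex_pair r (ren (lift (lift (subst0 z))) \<xi>))"
      proof
        assume "\<Lambda> \<tturnstile> inst3 z a b \<xi>"
        with ab show "\<Lambda> \<tturnstile> ex_pair r (ren (lift (lift (subst0 z))) \<xi>)"
          by (intro ex_pairI) (simp_all add: inst3_eq)
      next
        assume "\<Lambda> \<tturnstile> ex_pair r (ren (lift (lift (subst0 z))) \<xi>)"
        then show "\<Lambda> \<tturnstile> inst3 z a b \<xi>"
        proof (rule ex_pairE, unfold inst3_eq)
          fix \<Xi> a' b' assume "\<Lambda> \<preceq> \<Xi>" "\<Xi> \<tturnstile> is_pair r a' b'" "\<Xi> \<tturnstile> inst3 z a' b' \<xi>"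
          moreover from this have "\<Xi> \<tturnstile> a' \<^bold>= a" "\<Xi> \<tturnstile> b' \<^bold>= b"
            using pair_inj forces_mono[OF _ ab] by blast+
          ultimately show "\<Xi> \<tturnstile> inst3 z a b \<xi>"
            using forces_cong_ren unfolding inst3_def by blast
        qed
      qed
    qed
  qed
qed

section \<open>Closure conditions and set-generation\<close>

lemma forces_R_closed: "(\<Gamma> \<tturnstile> R_closed R \<alpha>) \<longleftrightarrow>
  (\<forall>\<Delta> r a b. \<Gamma> \<preceq> \<Delta> \<longrightarrow> (\<Delta> \<tturnstile> r \<^bold>\<in> R) \<longrightarrow> (\<Delta> \<tturnstile> is_pair r a b) \<longrightarrow> (\<Delta> \<tturnstile> a \<^bold>\<subseteq> \<alpha>) \<longrightarrow> (\<Delta> \<tturnstile> meets b \<alpha>))"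
  unfolding R_closed_def closed_under_def
  by (simp add: forces_BAll forces_Forall forces_Imp inst_def numeral_eq_Suc)
    (meson extends_refl extends_trans forces_mono)

lemma forces_R_biclosed: "(\<Gamma> \<tturnstile> R_biclosed R \<alpha>) \<longleftrightarrow>
  (\<forall>\<Delta> r a b. \<Gamma> \<preceq> \<Delta> \<longrightarrow> (\<Delta> \<tturnstile> r \<^bold>\<in> R) \<longrightarrow> (\<Delta> \<tturnstile> is_pair r a b) \<longrightarrow> (\<Delta> \<tturnstile> meets a \<alpha>) = (\<Delta> \<tturnstile> meets b \<alpha>))"
  unfolding R_biclosed_def biclosed_under_def
  by (simp add: forces_BAll forces_Forall forces_Imp forces_Iff inst_def numeral_eq_Suc)
    (meson extends_refl extends_trans forces_mono)

text \<open>A generating set serves every class with the same members. Hence both implications reduce to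
  finding, for a set of rules of one kind, a set of rules of the other kind with the same closed or
  biclosed subsets.\<close>

lemma set_generated_cong:
  assumes gen: "\<Gamma> \<tturnstile> set_generated \<C>"
    and eq: "\<And>\<Delta> \<alpha>. \<Gamma> \<preceq> \<Delta> \<Longrightarrow> (\<Delta> \<tturnstile> inst \<alpha> \<C>) = (\<Delta> \<tturnstile> inst \<alpha> \<D>)"
  shows "\<Gamma> \<tturnstile> set_generated \<D>"
proof -
  have *: "(\<Delta> \<tturnstile> inst G ((\<^bold>\<forall>[0] (ren (lift Suc) \<C>)) \<^bold>\<and> (\<^bold>\<forall> (ren (lift Suc) \<C> \<^bold>\<longrightarrow> \<chi>)))) \<longleftrightarrow>
    (\<forall>\<Theta> \<beta>. \<Delta> \<preceq> \<Theta> \<longrightarrow> (\<Theta> \<tturnstile> \<beta> \<^bold>\<in> G) \<longrightarrow> (\<Theta> \<tturnstile> inst \<beta> \<C>)) \<and>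
    (\<forall>\<Theta> \<alpha>. \<Delta> \<preceq> \<Theta> \<longrightarrow> (\<Theta> \<tturnstile> inst \<alpha> \<C>) \<longrightarrow> (\<Theta> \<tturnstile> inst \<alpha> (ren (lift (subst0 G)) \<chi>)))"
    for \<Delta> G \<C> \<chi>
  proof -
    let ?g = "lift (subst0 G)"
    have "inst G ((\<^bold>\<forall>[0] (ren (lift Suc) \<C>)) \<^bold>\<and> (\<^bold>\<forall> (ren (lift Suc) \<C> \<^bold>\<longrightarrow> \<chi>))) =
      ((\<^bold>\<forall>[G] (ren ?g (ren (lift Suc) \<C>))) \<^bold>\<and> (\<^bold>\<forall> (ren ?g (ren (lift Suc) \<C>) \<^bold>\<longrightarrow> ren ?g \<chi>)))"
      by (simp add: inst_def)
    moreover have "inst \<alpha> (ren ?g (ren (lift Suc) \<C>) \<^bold>\<longrightarrow> ren ?g \<chi>) = (inst \<alpha> \<C> \<^bold>\<longrightarrow> inst \<alpha> (ren ?g \<chi>))" for \<alpha>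
      by (subst inst_subst0_weaken1[of \<alpha> G, symmetric]) (simp add: inst_def)
    ultimately show ?thesis
      by (auto simp: forces_And forces_BAll forces_Forall forces_Imp inst_subst0_weaken1)
  qed
  show ?thesis
    using gen unfolding set_generated_def
  proof (rule forces_ExistsE)
    fix \<Delta> G assume "\<Gamma> \<preceq> \<Delta>"
      and "\<Delta> \<tturnstile> inst G ((\<^bold>\<forall>[0] (ren (lift Suc) \<C>))
       \<^bold>\<and> (\<^bold>\<forall> (ren (lift Suc) \<C> \<^bold>\<longrightarrow> (\<^bold>\<forall>[0] (\<^bold>\<exists>[2] (1 \<^bold>\<in> 0 \<^bold>\<and> 0 \<^bold>\<subseteq> 2))))))"
    then have "\<Delta> \<tturnstile> inst G ((\<^bold>\<forall>[0] (ren (lift Suc) \<D>))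
       \<^bold>\<and> (\<^bold>\<forall> (ren (lift Suc) \<D> \<^bold>\<longrightarrow> (\<^bold>\<forall>[0] (\<^bold>\<exists>[2] (1 \<^bold>\<in> 0 \<^bold>\<and> 0 \<^bold>\<subseteq> 2))))))"
      unfolding * using eq extends_trans by blast
    then show "\<Delta> \<tturnstile> \<^bold>\<exists> ((\<^bold>\<forall>[0] (ren (lift Suc) \<D>))
       \<^bold>\<and> (\<^bold>\<forall> (ren (lift Suc) \<D> \<^bold>\<longrightarrow> (\<^bold>\<forall>[0] (\<^bold>\<exists>[2] (1 \<^bold>\<in> 0 \<^bold>\<and> 0 \<^bold>\<subseteq> 2))))))"
      by (rule forces_ExistsI)
  qed
qed

lemma forces_NID_1: "(\<Gamma> \<tturnstile> NID_1) \<longleftrightarrow> (\<forall>\<Delta> S R. \<Gamma> \<preceq> \<Delta> \<longrightarrow> (\<Delta> \<tturnstile> \<^bold>\<forall>[R] (is_elementary_rule 0 (Suc S))) \<longrightarrow>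
    (\<Delta> \<tturnstile> set_generated (0 \<^bold>\<subseteq> Suc S \<^bold>\<and> R_closed (Suc R) 0)))"
  by (auto simp: NID_1_def set_generated_def forces_Forall forces_Imp inst_def numeral_eq_Suc)

lemma forces_NID_bi: "(\<Gamma> \<tturnstile> NID_bi) \<longleftrightarrow> (\<forall>\<Delta> S R. \<Gamma> \<preceq> \<Delta> \<longrightarrow> (\<Delta> \<tturnstile> \<^bold>\<forall>[R] (is_rule 0 (Suc S))) \<longrightarrow>
    (\<Delta> \<tturnstile> set_generated (0 \<^bold>\<subseteq> Suc S \<^bold>\<and> R_biclosed (Suc R) 0)))"
  by (auto simp: NID_bi_def set_generated_def forces_Forall forces_Imp inst_def numeral_eq_Suc)

section \<open>Closed subsets as biclosed subsets\<close>

text \<open>The pair \<open>z\<close> is the rule \<open>(a \<union> b, b)\<close> attached to \<open>(a, b)\<close>; the variables are those of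
  \<^const>\<open>over_pairs\<close>.\<close>

definition union_rule :: fm
  where "union_rule = pair_of 2 (0 \<^bold>\<in> 2 \<^bold>\<or> 0 \<^bold>\<in> 1) 0"

lemma is_set_union_rules:
  assumes "\<Gamma> \<tturnstile> \<^bold>\<forall>[R] (is_rule 0 (Suc S))"
  shows "\<Gamma> \<tturnstile> is_set (over_pairs R union_rule)"
proof (rule is_set_over_pairs[OF assms])
  fix \<Delta> a b
  have "\<Delta> \<tturnstile> is_set (pair_of 0 (ren (lift Suc) (0 \<^bold>\<in> Suc a \<^bold>\<or> 0 \<^bold>\<in> Suc b)) (Suc b))"
    by (intro is_set_pair_of is_set_Or is_set_mem)
  then show "\<Delta> \<tturnstile> is_set (ren (case_nat (Suc b) (case_nat (Suc a) (\<lambda>m. m))) union_rule)"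
    by (simp add: union_rule_def numeral_eq_Suc)
qed

lemma inst3_union: "inst3 p a b union_rule = pair_of p (0 \<^bold>\<in> Suc a \<^bold>\<or> 0 \<^bold>\<in> Suc b) b"
  by (simp add: inst3_def union_rule_def numeral_eq_Suc)

lemma union_rulesI:
  assumes Q: "collects \<Gamma> Q (over_pairs R union_rule)"
    and r: "\<Gamma> \<tturnstile> r \<^bold>\<in> R" "\<Gamma> \<tturnstile> is_pair r a b"
    and u: "collects \<Gamma> u (0 \<^bold>\<in> Suc a \<^bold>\<or> 0 \<^bold>\<in> Suc b)" "\<Gamma> \<tturnstile> is_pair p u b"
  shows "\<Gamma> \<tturnstile> p \<^bold>\<in> Q"
  unfolding collects_mem[OF Q]
  by (rule over_pairsI[OF r], unfold inst3_union) (rule pair_ofI[OF u])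

lemma union_rulesE:
  assumes Q: "collects \<Gamma> Q (over_pairs R union_rule)" and p: "\<Gamma> \<tturnstile> p \<^bold>\<in> Q"
    and *: "\<And>\<Delta> r a b u. \<Gamma> \<preceq> \<Delta> \<Longrightarrow> \<Delta> \<tturnstile> r \<^bold>\<in> R \<Longrightarrow> \<Delta> \<tturnstile> is_pair r a b \<Longrightarrow>
      collects \<Delta> u (0 \<^bold>\<in> Suc a \<^bold>\<or> 0 \<^bold>\<in> Suc b) \<Longrightarrow> \<Delta> \<tturnstile> is_pair p u b \<Longrightarrow> \<Delta> \<tturnstile> \<psi>"
  shows "\<Gamma> \<tturnstile> \<psi>"
  using p unfolding collects_mem[OF Q]
proof (rule over_pairsE, unfold inst3_union)
  fix \<Delta> r a b
  assume r: "\<Gamma> \<preceq> \<Delta>" "\<Delta> \<tturnstile> r \<^bold>\<in> R" "\<Delta> \<tturnstile> is_pair r a b"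
    and "\<Delta> \<tturnstile> pair_of p (0 \<^bold>\<in> Suc a \<^bold>\<or> 0 \<^bold>\<in> Suc b) b"
  from this(4) show "\<Delta> \<tturnstile> \<psi>"
    by (rule pair_ofE) (meson * r forces_mono extends_trans)
qed

lemma mem_unionE:
  assumes "collects \<Gamma> u (0 \<^bold>\<in> Suc a \<^bold>\<or> 0 \<^bold>\<in> Suc b)" "\<Gamma> \<tturnstile> x \<^bold>\<in> u"
    and "\<And>\<Delta>. \<Gamma> \<preceq> \<Delta> \<Longrightarrow> \<Delta> \<tturnstile> x \<^bold>\<in> a \<Longrightarrow> \<Delta> \<tturnstile> \<psi>" "\<And>\<Delta>. \<Gamma> \<preceq> \<Delta> \<Longrightarrow> \<Delta> \<tturnstile> x \<^bold>\<in> b \<Longrightarrow> \<Delta> \<tturnstile> \<psi>"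
  shows "\<Gamma> \<tturnstile> \<psi>"
proof -
  have "\<Gamma> \<tturnstile> x \<^bold>\<in> a \<^bold>\<or> x \<^bold>\<in> b" using assms(1,2) by (simp add: collects_def inst_def)
  then show ?thesis by (rule forces_OrE) (fact assms(3,4))+
qed

lemma mem_unionI:
  assumes "collects \<Gamma> u (0 \<^bold>\<in> Suc a \<^bold>\<or> 0 \<^bold>\<in> Suc b)" "(\<Gamma> \<tturnstile> x \<^bold>\<in> a) \<or> (\<Gamma> \<tturnstile> x \<^bold>\<in> b)"
  shows "\<Gamma> \<tturnstile> x \<^bold>\<in> u"
  using forces_OrI[OF assms(2)] assms(1) by (simp add: collects_def inst_def)

lemma sing_Subset: "\<Gamma> \<tturnstile> is_sing a x \<Longrightarrow> (\<Gamma> \<tturnstile> a \<^bold>\<subseteq> \<alpha>) = (\<Gamma> \<tturnstile> x \<^bold>\<in> \<alpha>)"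
  unfolding forces_Subset by (metis extends_refl forces_cong_mem(1) forces_mono forces_refl sing_mem)

lemma union_rules_are_rules:
  assumes R: "\<Gamma> \<tturnstile> \<^bold>\<forall>[R] (is_rule 0 (Suc S))"
    and Q: "collects \<Gamma> Q (over_pairs R union_rule)"
  shows "\<Gamma> \<tturnstile> \<^bold>\<forall>[Q] (is_rule 0 (Suc S))"
  unfolding forces_BAll
proof (intro HOL.allI HOL.impI)
  fix \<Delta> p assume le: "\<Gamma> \<preceq> \<Delta>" and "\<Delta> \<tturnstile> p \<^bold>\<in> Q"
  from collects_mono[OF le Q] this(2) have "\<Delta> \<tturnstile> is_rule p S"
  proof (rule union_rulesE)
    fix \<Theta> r a b u
    assume le': "\<Delta> \<preceq> \<Theta>" and r: "\<Theta> \<tturnstile> r \<^bold>\<in> R" "\<Theta> \<tturnstile> is_pair r a b"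
      and u: "collects \<Theta> u (0 \<^bold>\<in> Suc a \<^bold>\<or> 0 \<^bold>\<in> Suc b)" and p: "\<Theta> \<tturnstile> is_pair p u b"
    have "\<Theta> \<tturnstile> is_rule r S"
      using forces_mono[OF extends_trans[OF le le'] R] r(1) by (auto simp: forces_BAll inst_def)
    from rule_subsets[OF this r(2)] have ab: "\<Theta> \<tturnstile> a \<^bold>\<subseteq> S" "\<Theta> \<tturnstile> b \<^bold>\<subseteq> S" .
    have "\<Theta> \<tturnstile> u \<^bold>\<subseteq> S"
      unfolding forces_Subset
    proof (intro HOL.allI HOL.impI)
      fix \<Lambda> x assume "\<Theta> \<preceq> \<Lambda>" "\<Lambda> \<tturnstile> x \<^bold>\<in> u"
      from collects_mono[OF this(1) u] this(2) show "\<Lambda> \<tturnstile> x \<^bold>\<in> S"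
        by (rule mem_unionE) (meson \<open>\<Theta> \<preceq> \<Lambda>\<close> ab forces_mono Subset_mem)+
    qed
    with p show "\<Theta> \<tturnstile> is_rule p S" using ab(2) by (rule is_ruleI)
  qed
  then show "\<Delta> \<tturnstile> inst p (is_rule 0 (Suc S))" by (simp add: inst_def)
qed

text \<open>From \<open>b \<between> \<alpha>\<close> always follows \<open>a \<union> b \<between> \<alpha>\<close>, so \<open>\<alpha>\<close> is biclosed under \<open>(a \<union> b, b)\<close> iff
  \<open>a \<between> \<alpha>\<close> implies \<open>b \<between> \<alpha>\<close>. For a singleton \<open>a\<close> the condition \<open>a \<between> \<alpha>\<close> is the same as \<open>a \<subseteq> \<alpha>\<close>, so this is
  closure under \<open>(a, b)\<close>.\<close>

lemma union_rules_biclosed: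
  assumes R: "\<Gamma> \<tturnstile> \<^bold>\<forall>[R] (is_elementary_rule 0 (Suc S))"
    and Q: "collects \<Gamma> Q (over_pairs R union_rule)"
  shows "(\<Gamma> \<tturnstile> R_biclosed Q \<alpha>) = (\<Gamma> \<tturnstile> R_closed R \<alpha>)"
proof
  assume bi: "\<Gamma> \<tturnstile> R_biclosed Q \<alpha>"
  show "\<Gamma> \<tturnstile> R_closed R \<alpha>"
    unfolding forces_R_closed
  proof (intro HOL.allI HOL.impI)
    fix \<Delta> r a b
    assume le1: "\<Gamma> \<preceq> \<Delta>" and F: "\<Delta> \<tturnstile> r \<^bold>\<in> R" "\<Delta> \<tturnstile> is_pair r a b" "\<Delta> \<tturnstile> a \<^bold>\<subseteq> \<alpha>"
    have "\<Delta> \<tturnstile> is_elementary_rule r S"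
      using forces_mono[OF le1 R] F(1) by (auto simp: forces_BAll inst_def)
    then show "\<Delta> \<tturnstile> meets b \<alpha>"
      using F(2)
    proof (rule elementary_rule_sing)
      fix \<Theta> x assume le2: "\<Delta> \<preceq> \<Theta>" and x: "\<Theta> \<tturnstile> is_sing a x"
      show "\<Theta> \<tturnstile> meets b \<alpha>"
      proof (rule is_setE[OF is_set_Or[OF is_set_mem[of _ a] is_set_mem[of _ b]]])
        fix \<Lambda> u assume le3: "\<Theta> \<preceq> \<Lambda>" and u: "collects \<Lambda> u (0 \<^bold>\<in> Suc a \<^bold>\<or> 0 \<^bold>\<in> Suc b)"
        show "\<Lambda> \<tturnstile> meets b \<alpha>"
        proof (rule pair_exists[of _ u b])
          \<comment> \<open>The point \<open>x\<close> of \<open>a \<subseteq> \<alpha>\<close> makes \<open>a \<union> b\<close> meet \<open>\<alpha>\<close>; the rule \<open>(a \<union> b, b)\<close> passes this on to \<open>b\<close>.\<close>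
          fix \<Xi> p assume le4: "\<Lambda> \<preceq> \<Xi>" and p: "\<Xi> \<tturnstile> is_pair p u b"
          have le: "\<Theta> \<preceq> \<Xi>" "\<Delta> \<preceq> \<Xi>" "\<Gamma> \<preceq> \<Xi>" using le1 le2 le3 le4 by (meson extends_trans)+
          note F = F[THEN forces_mono[OF le(2)]] and x = forces_mono[OF le(1) x]
            and u = collects_mono[OF le4 u] and Q = collects_mono[OF le(3) Q]
          have "\<Xi> \<tturnstile> x \<^bold>\<in> a" using x by (simp add: sing_mem)
          then have "\<Xi> \<tturnstile> meets u \<alpha>"
            using u F(3) by (meson mem_unionI Subset_mem forces_meetsI)
          moreover have "\<Xi> \<tturnstile> p \<^bold>\<in> Q" by (rule union_rulesI[OF Q F(1,2) u p])
          ultimately show "\<Xi> \<tturnstile> meets b \<alpha>"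
            using bi le(3) p unfolding forces_R_biclosed by blast
        qed
      qed
    qed
  qed
next
  assume cl: "\<Gamma> \<tturnstile> R_closed R \<alpha>"
  show "\<Gamma> \<tturnstile> R_biclosed Q \<alpha>"
    unfolding forces_R_biclosed
  proof (intro HOL.allI HOL.impI)
    fix \<Delta> p c d
    assume le1: "\<Gamma> \<preceq> \<Delta>" and p: "\<Delta> \<tturnstile> p \<^bold>\<in> Q" and cd: "\<Delta> \<tturnstile> is_pair p c d"
    have "\<Delta> \<tturnstile> meets c \<alpha> \<^bold>\<longleftrightarrow> meets d \<alpha>"
      using collects_mono[OF le1 Q] p
    proof (rule union_rulesE)
      fix \<Theta> r a b u
      assume le2: "\<Delta> \<preceq> \<Theta>" and r: "\<Theta> \<tturnstile> r \<^bold>\<in> R" "\<Theta> \<tturnstile> is_pair r a b"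
        and u: "collects \<Theta> u (0 \<^bold>\<in> Suc a \<^bold>\<or> 0 \<^bold>\<in> Suc b)" and ub: "\<Theta> \<tturnstile> is_pair p u b"
      have cu: "\<Theta> \<tturnstile> c \<^bold>= u" and db: "\<Theta> \<tturnstile> d \<^bold>= b"
        using pair_inj[OF forces_mono[OF le2 cd] ub] .
      have el: "\<Theta> \<tturnstile> is_elementary_rule r S"
        using forces_mono[OF extends_trans[OF le1 le2] R] r(1) by (auto simp: forces_BAll inst_def)
      have "\<Theta> \<tturnstile> meets u \<alpha> \<^bold>\<longleftrightarrow> meets b \<alpha>"
        unfolding forces_Iff
      proof (intro HOL.allI HOL.impI iffI)
        fix \<Lambda> assume le3: "\<Theta> \<preceq> \<Lambda>" and "\<Lambda> \<tturnstile> meets u \<alpha>"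
        from this(2) show "\<Lambda> \<tturnstile> meets b \<alpha>"
        proof (rule forces_meetsE)
          fix \<Xi> w assume le4: "\<Lambda> \<preceq> \<Xi>" and w: "\<Xi> \<tturnstile> w \<^bold>\<in> u" "\<Xi> \<tturnstile> w \<^bold>\<in> \<alpha>"
          show "\<Xi> \<tturnstile> meets b \<alpha>"
            using collects_mono[OF extends_trans[OF le3 le4] u] w(1)
          proof (rule mem_unionE)
            fix \<Psi> assume le5: "\<Xi> \<preceq> \<Psi>" and wa: "\<Psi> \<tturnstile> w \<^bold>\<in> a"
            have le: "\<Theta> \<preceq> \<Psi>" using le3 le4 le5 by (meson extends_trans)
            show "\<Psi> \<tturnstile> meets b \<alpha>"
              using el[THEN forces_mono[OF le]] r(2)[THEN forces_mono[OF le]]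
            proof (rule elementary_rule_sing)
              fix \<Omega> x assume le6: "\<Psi> \<preceq> \<Omega>" and x: "\<Omega> \<tturnstile> is_sing a x"
              have "\<Omega> \<tturnstile> w \<^bold>= x" using forces_mono[OF le6 wa] x by (simp add: sing_mem)
              moreover have "\<Omega> \<tturnstile> w \<^bold>\<in> \<alpha>" using w(2) le5 le6 by (meson forces_mono)
              ultimately have "\<Omega> \<tturnstile> x \<^bold>\<in> \<alpha>" using forces_cong_mem(1) by blast
              then have "\<Omega> \<tturnstile> a \<^bold>\<subseteq> \<alpha>" using x by (simp add: sing_Subset)
              moreover have "\<Gamma> \<preceq> \<Omega>" "\<Theta> \<preceq> \<Omega>" using le1 le2 le le6 by (meson extends_trans)+
              ultimately show "\<Omega> \<tturnstile> meets b \<alpha>"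
                using cl r unfolding forces_R_closed by (meson forces_mono)
            qed
          qed (meson forces_meetsI forces_mono w(2))
        qed
      next
        fix \<Lambda> assume le3: "\<Theta> \<preceq> \<Lambda>" and "\<Lambda> \<tturnstile> meets b \<alpha>"
        from this(2) show "\<Lambda> \<tturnstile> meets u \<alpha>"
          by (rule forces_meetsE) (meson mem_unionI forces_meetsI collects_mono u le3)
      qed
      then show "\<Theta> \<tturnstile> meets c \<alpha> \<^bold>\<longleftrightarrow> meets d \<alpha>"
        using cu db unfolding forces_Iff by (metis forces_cong_mem(3) forces_mono)
    qed
    then show "(\<Delta> \<tturnstile> meets c \<alpha>) = (\<Delta> \<tturnstile> meets d \<alpha>)" by (simp add: forces_Iff)
  qed
qed

lemma NID_bi_imp_NID_1:
  assumes "\<Gamma> \<tturnstile> NID_bi"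
  shows "\<Gamma> \<tturnstile> NID_1"
  unfolding forces_NID_1
proof (intro HOL.allI HOL.impI)
  fix \<Delta> S R assume le: "\<Gamma> \<preceq> \<Delta>" and el: "\<Delta> \<tturnstile> \<^bold>\<forall>[R] (is_elementary_rule 0 (Suc S))"
  have R: "\<Delta> \<tturnstile> \<^bold>\<forall>[R] (is_rule 0 (Suc S))"
    using el by (simp add: forces_BAll inst_def elementary_rule_is_rule)
  from is_set_union_rules[OF R] show "\<Delta> \<tturnstile> set_generated (0 \<^bold>\<subseteq> Suc S \<^bold>\<and> R_closed (Suc R) 0)"
  proof (rule is_setE)
    fix \<Theta> Q assume le': "\<Delta> \<preceq> \<Theta>" and Q: "collects \<Theta> Q (over_pairs R union_rule)"
    have "\<Theta> \<tturnstile> set_generated (0 \<^bold>\<subseteq> Suc S \<^bold>\<and> R_biclosed (Suc Q) 0)"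
      using assms union_rules_are_rules[OF forces_mono[OF le' R] Q] extends_trans[OF le le']
      unfolding forces_NID_bi by blast
    then show "\<Theta> \<tturnstile> set_generated (0 \<^bold>\<subseteq> Suc S \<^bold>\<and> R_closed (Suc R) 0)"
    proof (rule set_generated_cong)
      fix \<Lambda> \<alpha> assume "\<Theta> \<preceq> \<Lambda>"
      then show "(\<Lambda> \<tturnstile> inst \<alpha> (0 \<^bold>\<subseteq> Suc S \<^bold>\<and> R_biclosed (Suc Q) 0)) =
          (\<Lambda> \<tturnstile> inst \<alpha> (0 \<^bold>\<subseteq> Suc S \<^bold>\<and> R_closed (Suc R) 0))"
        using union_rules_biclosed[of \<Lambda> R S Q \<alpha>] el Q le'
        by (simp add: inst_def forces_And) (meson collects_mono extends_trans forces_mono)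
    qed
  qed
qed

section \<open>Biclosed subsets as closed subsets\<close>

text \<open>The pair \<open>z\<close> is one of the rules \<open>({x}, b)\<close> with \<open>x \<in> a\<close>, or \<open>({x}, a)\<close> with \<open>x \<in> b\<close>, attached
  to \<open>(a, b)\<close>; the variables are those of \<^const>\<open>over_pairs\<close>.\<close>

definition singleton_rules :: fm
  where "singleton_rules = ((\<^bold>\<exists>[1] (pair_of 3 (0 \<^bold>= 1) 1)) \<^bold>\<or> (\<^bold>\<exists>[0] (pair_of 3 (0 \<^bold>= 1) 2)))"

lemma is_set_singleton_rules:
  assumes "\<Gamma> \<tturnstile> \<^bold>\<forall>[R] (is_rule 0 (Suc S))"
  shows "\<Gamma> \<tturnstile> is_set (over_pairs R singleton_rules)"
proof (rule is_set_over_pairs[OF assms])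
  fix \<Delta> a b
  have *: "\<Delta> \<tturnstile> is_set (\<^bold>\<exists>[Suc c] (pair_of 1 (0 \<^bold>= 1) (Suc (Suc d))))" for c d
  proof (rule is_set_BEx)
    fix \<Theta> x
    have "\<Theta> \<tturnstile> is_set (pair_of 0 (ren (lift Suc) (0 \<^bold>= Suc x)) (Suc d))"
      by (intro is_set_pair_of is_set_sing)
    then show "\<Theta> \<tturnstile> is_set (inst (Suc x) (pair_of 1 (0 \<^bold>= 1) (Suc (Suc d))))"
      by (simp add: inst_def)
  qed
  show "\<Delta> \<tturnstile> is_set (ren (case_nat (Suc b) (case_nat (Suc a) (\<lambda>m. m))) singleton_rules)"
    using is_set_Or[OF *[of a b] *[of b a]] by (simp add: singleton_rules_def numeral_eq_Suc)
qed

lemma inst3_singleton: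
  "inst3 p a b singleton_rules =
    ((\<^bold>\<exists>[a] (pair_of (Suc p) (0 \<^bold>= 1) (Suc b))) \<^bold>\<or> (\<^bold>\<exists>[b] (pair_of (Suc p) (0 \<^bold>= 1) (Suc a))))"
  by (simp add: inst3_def singleton_rules_def numeral_eq_Suc)

lemma ex_pair_of_singI:
  assumes "\<Gamma> \<tturnstile> x \<^bold>\<in> a" "\<Gamma> \<tturnstile> is_sing s x" "\<Gamma> \<tturnstile> is_pair p s b"
  shows "\<Gamma> \<tturnstile> \<^bold>\<exists>[a] (pair_of (Suc p) (0 \<^bold>= 1) (Suc b))"
proof -
  have "\<Gamma> \<tturnstile> pair_of p (0 \<^bold>= Suc x) b"
    by (rule pair_ofI[of _ s]) (simp_all add: collects_sing assms)
  then show ?thesis by (intro forces_BExI[OF assms(1)]) (simp add: inst_def)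
qed

lemma ex_pair_of_singE:
  assumes "\<Gamma> \<tturnstile> \<^bold>\<exists>[a] (pair_of (Suc p) (0 \<^bold>= 1) (Suc b))"
    and *: "\<And>\<Delta> x s. \<Gamma> \<preceq> \<Delta> \<Longrightarrow> \<Delta> \<tturnstile> x \<^bold>\<in> a \<Longrightarrow> \<Delta> \<tturnstile> is_sing s x \<Longrightarrow> \<Delta> \<tturnstile> is_pair p s b \<Longrightarrow> \<Delta> \<tturnstile> \<psi>"
  shows "\<Gamma> \<tturnstile> \<psi>"
  using assms(1)
proof (rule forces_BExE)
  fix \<Delta> x assume le: "\<Gamma> \<preceq> \<Delta>" "\<Delta> \<tturnstile> x \<^bold>\<in> a" and "\<Delta> \<tturnstile> inst x (pair_of (Suc p) (0 \<^bold>= 1) (Suc b))"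
  then have "\<Delta> \<tturnstile> pair_of p (0 \<^bold>= Suc x) b" by (simp add: inst_def)
  then show "\<Delta> \<tturnstile> \<psi>"
    by (rule pair_ofE, unfold collects_sing) (meson * le forces_mono extends_trans)
qed

text \<open>The two families of rules differ only by exchanging \<open>a\<close> and \<open>b\<close>; the pair \<open>c, d\<close> is \<open>a, b\<close> in either
  order, so that each later argument is given once for both families.\<close>

lemma singleton_rulesI:
  assumes Q: "collects \<Gamma> Q (over_pairs R singleton_rules)"
    and r: "\<Gamma> \<tturnstile> r \<^bold>\<in> R" "\<Gamma> \<tturnstile> is_pair r a b"
    and cd: "c = a \<and> d = b \<or> c = b \<and> d = a"
    and x: "\<Gamma> \<tturnstile> x \<^bold>\<in> c" "\<Gamma> \<tturnstile> is_sing s x" "\<Gamma> \<tturnstile> is_pair p s d"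
  shows "\<Gamma> \<tturnstile> p \<^bold>\<in> Q"
  unfolding collects_mem[OF Q]
proof (rule over_pairsI[OF r], unfold inst3_singleton)
  have "\<Gamma> \<tturnstile> \<^bold>\<exists>[c] (pair_of (Suc p) (0 \<^bold>= 1) (Suc d))" by (rule ex_pair_of_singI[OF x])
  with cd show "\<Gamma> \<tturnstile> (\<^bold>\<exists>[a] (pair_of (Suc p) (0 \<^bold>= 1) (Suc b))) \<^bold>\<or> (\<^bold>\<exists>[b] (pair_of (Suc p) (0 \<^bold>= 1) (Suc a)))"
    by (auto intro: forces_OrI1 forces_OrI2)
qed

lemma singleton_rulesE:
  assumes Q: "collects \<Gamma> Q (over_pairs R singleton_rules)" and p: "\<Gamma> \<tturnstile> p \<^bold>\<in> Q"
    and *: "\<And>\<Delta> r a b c d x s. \<Gamma> \<preceq> \<Delta> \<Longrightarrow> \<Delta> \<tturnstile> r \<^bold>\<in> R \<Longrightarrow> \<Delta> \<tturnstile> is_pair r a b \<Longrightarrow>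
      c = a \<and> d = b \<or> c = b \<and> d = a \<Longrightarrow>
      \<Delta> \<tturnstile> x \<^bold>\<in> c \<Longrightarrow> \<Delta> \<tturnstile> is_sing s x \<Longrightarrow> \<Delta> \<tturnstile> is_pair p s d \<Longrightarrow> \<Delta> \<tturnstile> \<psi>"
  shows "\<Gamma> \<tturnstile> \<psi>"
  using p unfolding collects_mem[OF Q]
proof (rule over_pairsE, unfold inst3_singleton)
  fix \<Delta> r a b
  assume le: "\<Gamma> \<preceq> \<Delta>" and r: "\<Delta> \<tturnstile> r \<^bold>\<in> R" "\<Delta> \<tturnstile> is_pair r a b"
    and "\<Delta> \<tturnstile> (\<^bold>\<exists>[a] (pair_of (Suc p) (0 \<^bold>= 1) (Suc b))) \<^bold>\<or> (\<^bold>\<exists>[b] (pair_of (Suc p) (0 \<^bold>= 1) (Suc a)))"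
  have step: "\<Theta> \<tturnstile> \<psi>" if "\<Delta> \<preceq> \<Theta>" "\<Theta> \<tturnstile> \<^bold>\<exists>[c] (pair_of (Suc p) (0 \<^bold>= 1) (Suc d))"
      "c = a \<and> d = b \<or> c = b \<and> d = a" for \<Theta> c d
    using that(2)
  proof (rule ex_pair_of_singE)
    fix \<Lambda> x s assume "\<Theta> \<preceq> \<Lambda>" and x: "\<Lambda> \<tturnstile> x \<^bold>\<in> c" "\<Lambda> \<tturnstile> is_sing s x" "\<Lambda> \<tturnstile> is_pair p s d"
    then have le': "\<Delta> \<preceq> \<Lambda>" using that(1) by (meson extends_trans)
    show "\<Lambda> \<tturnstile> \<psi>"
      by (rule *[OF extends_trans[OF le le'] forces_mono[OF le' r(1)] forces_mono[OF le' r(2)] that(3) x])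
  qed
  show "\<Delta> \<tturnstile> \<psi>"
    by (rule forces_OrE[OF \<open>\<Delta> \<tturnstile> _ \<^bold>\<or> _\<close>]) (use step in blast)+
qed

lemma rule_swapped_subsets:
  assumes "\<Gamma> \<tturnstile> \<^bold>\<forall>[R] (is_rule 0 (Suc S))" "\<Gamma> \<tturnstile> r \<^bold>\<in> R" "\<Gamma> \<tturnstile> is_pair r a b"
    and "c = a \<and> d = b \<or> c = b \<and> d = a"
  shows "\<Gamma> \<tturnstile> c \<^bold>\<subseteq> S" "\<Gamma> \<tturnstile> d \<^bold>\<subseteq> S"
proof -
  have "\<Gamma> \<tturnstile> is_rule r S" using assms(1,2) by (auto simp: forces_BAll inst_def)
  from rule_subsets[OF this assms(3)] assms(4) show "\<Gamma> \<tturnstile> c \<^bold>\<subseteq> S" "\<Gamma> \<tturnstile> d \<^bold>\<subseteq> S" by auto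
qed

lemma singleton_rules_are_elementary:
  assumes R: "\<Gamma> \<tturnstile> \<^bold>\<forall>[R] (is_rule 0 (Suc S))"
    and Q: "collects \<Gamma> Q (over_pairs R singleton_rules)"
  shows "\<Gamma> \<tturnstile> \<^bold>\<forall>[Q] (is_elementary_rule 0 (Suc S))"
  unfolding forces_BAll
proof (intro HOL.allI HOL.impI)
  fix \<Delta> p assume le: "\<Gamma> \<preceq> \<Delta>" and "\<Delta> \<tturnstile> p \<^bold>\<in> Q"
  from collects_mono[OF le Q] this(2) have "\<Delta> \<tturnstile> is_elementary_rule p S"
  proof (rule singleton_rulesE)
    fix \<Theta> r a b c d x s
    assume le': "\<Delta> \<preceq> \<Theta>" and r: "\<Theta> \<tturnstile> r \<^bold>\<in> R" "\<Theta> \<tturnstile> is_pair r a b" "c = a \<and> d = b \<or> c = b \<and> d = a"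
      and x: "\<Theta> \<tturnstile> x \<^bold>\<in> c" "\<Theta> \<tturnstile> is_sing s x" and p: "\<Theta> \<tturnstile> is_pair p s d"
    from rule_swapped_subsets[OF forces_mono[OF extends_trans[OF le le'] R] r]
    have "\<Theta> \<tturnstile> c \<^bold>\<subseteq> S" "\<Theta> \<tturnstile> d \<^bold>\<subseteq> S" .
    then have "\<Theta> \<tturnstile> s \<^bold>\<subseteq> S" using x by (simp add: sing_Subset Subset_mem)
    with p show "\<Theta> \<tturnstile> is_elementary_rule p S" using \<open>\<Theta> \<tturnstile> d \<^bold>\<subseteq> S\<close> x(2) by (rule is_elementary_ruleI)
  qed
  then show "\<Delta> \<tturnstile> inst p (is_elementary_rule 0 (Suc S))" by (simp add: inst_def)
qed

text \<open>Closure under all \<open>({x}, d)\<close> with \<open>x \<in> c\<close> says that any \<open>x \<in> c \<inter> \<alpha>\<close> yields \<open>d \<between> \<alpha>\<close>, that is,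
  \<open>c \<between> \<alpha>\<close> implies \<open>d \<between> \<alpha>\<close>. For both orders of \<open>a\<close> and \<open>b\<close> together this is biclosure under \<open>(a, b)\<close>.\<close>

lemma singleton_rules_closed:
  assumes Q: "collects \<Gamma> Q (over_pairs R singleton_rules)"
  shows "(\<Gamma> \<tturnstile> R_closed Q \<alpha>) = (\<Gamma> \<tturnstile> R_biclosed R \<alpha>)"
proof
  assume cl: "\<Gamma> \<tturnstile> R_closed Q \<alpha>"
  have half: "\<Delta> \<tturnstile> meets d \<alpha>"
    if le1: "\<Gamma> \<preceq> \<Delta>" and r: "\<Delta> \<tturnstile> r \<^bold>\<in> R" "\<Delta> \<tturnstile> is_pair r a b" and cd: "c = a \<and> d = b \<or> c = b \<and> d = a"
      and c: "\<Delta> \<tturnstile> meets c \<alpha>" for \<Delta> r a b c d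
    using c
  proof (rule forces_meetsE)
    fix \<Theta> x assume le2: "\<Delta> \<preceq> \<Theta>" and x: "\<Theta> \<tturnstile> x \<^bold>\<in> c" "\<Theta> \<tturnstile> x \<^bold>\<in> \<alpha>"
    show "\<Theta> \<tturnstile> meets d \<alpha>"
    proof (rule is_setE[OF is_set_sing[of _ x]], unfold collects_sing)
      fix \<Lambda> s assume le3: "\<Theta> \<preceq> \<Lambda>" and s: "\<Lambda> \<tturnstile> is_sing s x"
      show "\<Lambda> \<tturnstile> meets d \<alpha>"
      proof (rule pair_exists[of _ s d])
        fix \<Xi> p assume le4: "\<Lambda> \<preceq> \<Xi>" and p: "\<Xi> \<tturnstile> is_pair p s d"
        have le: "\<Theta> \<preceq> \<Xi>" "\<Delta> \<preceq> \<Xi>" "\<Gamma> \<preceq> \<Xi>" using le1 le2 le3 le4 by (meson extends_trans)+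
        note r = r[THEN forces_mono[OF le(2)]] and x = x[THEN forces_mono[OF le(1)]]
          and s = forces_mono[OF le4 s]
        have "\<Xi> \<tturnstile> p \<^bold>\<in> Q" by (rule singleton_rulesI[OF collects_mono[OF le(3) Q] r cd x(1) s p])
        moreover have "\<Xi> \<tturnstile> s \<^bold>\<subseteq> \<alpha>" using s x(2) by (simp add: sing_Subset)
        ultimately show "\<Xi> \<tturnstile> meets d \<alpha>" using cl le(3) p unfolding forces_R_closed by blast
      qed
    qed
  qed
  show "\<Gamma> \<tturnstile> R_biclosed R \<alpha>" unfolding forces_R_biclosed using half by blast
next
  assume bi: "\<Gamma> \<tturnstile> R_biclosed R \<alpha>"
  show "\<Gamma> \<tturnstile> R_closed Q \<alpha>"
    unfolding forces_R_closed
  proof (intro HOL.allI HOL.impI)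
    fix \<Delta> p c' d'
    assume le: "\<Gamma> \<preceq> \<Delta>" and p: "\<Delta> \<tturnstile> p \<^bold>\<in> Q" and c'd': "\<Delta> \<tturnstile> is_pair p c' d'" "\<Delta> \<tturnstile> c' \<^bold>\<subseteq> \<alpha>"
    from collects_mono[OF le Q] p show "\<Delta> \<tturnstile> meets d' \<alpha>"
    proof (rule singleton_rulesE)
      fix \<Theta> r a b c d x s
      assume le': "\<Delta> \<preceq> \<Theta>" and r: "\<Theta> \<tturnstile> r \<^bold>\<in> R" "\<Theta> \<tturnstile> is_pair r a b" and cd: "c = a \<and> d = b \<or> c = b \<and> d = a"
        and x: "\<Theta> \<tturnstile> x \<^bold>\<in> c" "\<Theta> \<tturnstile> is_sing s x" and p: "\<Theta> \<tturnstile> is_pair p s d"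
      note c'd' = c'd'[THEN forces_mono[OF le']]
      have "\<Theta> \<tturnstile> s \<^bold>\<subseteq> \<alpha>" using pair_inj(1)[OF c'd'(1) p] c'd'(2) forces_cong_mem(4) by blast
      then have "\<Theta> \<tturnstile> x \<^bold>\<in> \<alpha>" using x(2) by (simp add: sing_Subset)
      with x(1) have "\<Theta> \<tturnstile> meets c \<alpha>" by (rule forces_meetsI)
      moreover have "(\<Theta> \<tturnstile> meets a \<alpha>) = (\<Theta> \<tturnstile> meets b \<alpha>)"
        using bi r extends_trans[OF le le'] unfolding forces_R_biclosed by blast
      ultimately have "\<Theta> \<tturnstile> meets d \<alpha>" using cd by auto
      then show "\<Theta> \<tturnstile> meets d' \<alpha>" using pair_inj(2)[OF c'd'(1) p] forces_cong_mem(3) by blast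
    qed
  qed
qed

lemma NID_1_imp_NID_bi:
  assumes "\<Gamma> \<tturnstile> NID_1"
  shows "\<Gamma> \<tturnstile> NID_bi"
  unfolding forces_NID_bi
proof (intro HOL.allI HOL.impI)
  fix \<Delta> S R assume le: "\<Gamma> \<preceq> \<Delta>" and R: "\<Delta> \<tturnstile> \<^bold>\<forall>[R] (is_rule 0 (Suc S))"
  from is_set_singleton_rules[OF R] show "\<Delta> \<tturnstile> set_generated (0 \<^bold>\<subseteq> Suc S \<^bold>\<and> R_biclosed (Suc R) 0)"
  proof (rule is_setE)
    fix \<Theta> Q assume le': "\<Delta> \<preceq> \<Theta>" and Q: "collects \<Theta> Q (over_pairs R singleton_rules)"
    have "\<Theta> \<tturnstile> set_generated (0 \<^bold>\<subseteq> Suc S \<^bold>\<and> R_closed (Suc Q) 0)"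
      using assms singleton_rules_are_elementary[OF forces_mono[OF le' R] Q] extends_trans[OF le le']
      unfolding forces_NID_1 by blast
    then show "\<Theta> \<tturnstile> set_generated (0 \<^bold>\<subseteq> Suc S \<^bold>\<and> R_biclosed (Suc R) 0)"
    proof (rule set_generated_cong)
      fix \<Lambda> \<alpha> assume "\<Theta> \<preceq> \<Lambda>"
      then show "(\<Lambda> \<tturnstile> inst \<alpha> (0 \<^bold>\<subseteq> Suc S \<^bold>\<and> R_closed (Suc Q) 0)) =
          (\<Lambda> \<tturnstile> inst \<alpha> (0 \<^bold>\<subseteq> Suc S \<^bold>\<and> R_biclosed (Suc R) 0))"
        using singleton_rules_closed[OF collects_mono[OF _ Q]]
        by (simp add: inst_def forces_And)
    qed
  qed
qed

section \<open>The equivalence\<close>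

theorem proposition8: "ECST \<turnstile> NID_1 \<^bold>\<longleftrightarrow> NID_bi"
proof -
  have "ECST \<in> {\<Gamma>. ECST \<subseteq> \<Gamma> \<and> (\<exists>N. \<forall>\<phi>\<in>\<Gamma>. fv_bound \<phi> \<le> N)}"
    using ECST_closed by fastforce
  then have "Rep_ctx (Abs_ctx ECST) = ECST" by (rule Abs_ctx_inverse)
  moreover have "Abs_ctx ECST \<tturnstile> NID_1 \<^bold>\<longleftrightarrow> NID_bi"
    unfolding forces_Iff using NID_1_imp_NID_bi NID_bi_imp_NID_1 by blast
  ultimately show ?thesis by (simp add: forces_def)
qed

end
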